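(* Consider the $M$-group Curie-Weiss model with a heterogeneous (i.e. positive definite) coupling matrix $J$ with positive entries, in the low temperature regime. Assume that the function $$F(y)=\frac12\sum_{\lambda,\nu=1}^M (J^{-1})_{\lambda\nu}\,y_\lambda y_\nu-\sum_{\lambda=1}^M\alpha_\lambda\ln\cosh(y_\lambda),\qquad y\in\mathbb{R}^M,$$ has at most one local minimum in each orthant of $\mathbb{R}^M$, let $\bar m\in\mathbb{R}^M$ be the local minimum in the positive orthant, and set $m:=\tanh\bar m$ with $\tanh$ applied componentwise. Then $$\left(\frac{S_1}{N_1},\ldots,\frac{S_M}{N_M}\right)\Longrightarrow\frac12\left(\delta_{-m}+\delta_m\right)\quad\text{as }N\to\infty.$$
   Context: Setting. Fix $M\in\mathbb{N}$. For each $N$ there are group sizes $N_1,\ldots,N_M\in\mathbb{N}$ with $\sum_\lambda N_\lambda=N$, and as $N\to\infty$ each $N_\lambda\to\infty$ and $N_\lambda/N\to\alpha_\lambda$, where $\alpha_\lambda\ge 0$ (possibly $0$) and $\sum_\lambda\alpha_\lambda=1$. For a fixed positive definite real symmetric $M\times M$ coupling matrix $J=(J_{\lambda\mu})$ (a heterogeneous coupling matrix), the $M$-group Curie-Weiss model is the collection of $\{-1,1\}$-valued random variables $X_{\lambda i}$ ($1\le\lambda\le M$, $1\le i\le N_\lambda$) with $$\mathbb{P}(X_{11}=x_{11},\ldots,X_{MN_M}=x_{MN_M})=Z^{-1}\exp\Big(\frac{1}{2N}\sum_{\lambda,\mu=1}^M J_{\lambda\mu}\sum_{i=1}^{N_\lambda}\sum_{j=1}^{N_\mu}x_{\lambda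 i}x_{\mu j}\Big),$$ $Z$ being the normalising constant. Put $S_\lambda=\sum_{i=1}^{N_\lambda}X_{\lambda i}$. The low temperature regime is the case that $H=J^{-1}-\mathrm{diag}(\alpha_1,\ldots,\alpha_M)$ is not positive semi-definite. "Positive entries" means strictly positive entries. $\delta_x$ is the Dirac measure at $x\in\mathbb{R}^M$; $\Longrightarrow$ denotes weak convergence of the distributions. *)

theory Defs
  imports "HOL-Probability.Probability"
begin

definition positive_definite :: "real^'n^'n \<Rightarrow> bool" where
  "positive_definite A \<longleftrightarrow> (\<forall>x. x \<noteq> 0 \<longrightarrow> x \<bullet> (A *v x) > 0)"

definition positive_semidefinite :: "real^'n^'n \<Rightarrow> bool" where
  "positive_semidefinite A \<longleftrightarrow> (\<forall>x. x \<bullet> (A *v x) \<ge> 0)"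

definition diagonal_matrix :: "real^'n \<Rightarrow> real^'n^'n" where
  "diagonal_matrix a = (\<chi> i j. if i = j then a $ i else 0)"

(* Non-strict local minimum with respect to the whole space. *)
definition local_minimum :: "('a::topological_space \<Rightarrow> real) \<Rightarrow> 'a \<Rightarrow> bool" where
  "local_minimum f y \<longleftrightarrow> (\<forall>\<^sub>F z in nhds y. f y \<le> f z)"

(* The open orthant with sign vector s (entries 1 or -1). *)
definition orthant :: "real^'n \<Rightarrow> (real^'n) set" where
  "orthant s = {y. \<forall>i. s $ i * y $ i > 0}"

(* The library's weak convergence is specific to the real line (distribution functions). *)
definition weakly_converges ::
    "(nat \<Rightarrow> 'a::topological_space measure) \<Rightarrow> 'a measure \<Rightarrow> bool" where
  "weakly_converges \<mu> \<nu> \<longleftrightarrow>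
     (\<forall>f :: 'a \<Rightarrow> real. continuous_on UNIV f \<and> bounded (range f) \<longrightarrow>
        (\<lambda>n. \<integral>x. f x \<partial>\<mu> n) \<longlonglongrightarrow> (\<integral>x. f x \<partial>\<nu>))"

(* Sum of two measures on the same sigma-algebra; meaningful only if sets M = sets N. *)
definition add_measure :: "'a measure \<Rightarrow> 'a measure \<Rightarrow> 'a measure" where
  "add_measure M N = measure_of (space M) (sets M) (\<lambda>A. emeasure M A + emeasure N A)"

lemma space_add_measure [simp]: "space (add_measure M N) = space M"
  and sets_add_measure [simp, measurable_cong]: "sets (add_measure M N) = sets M"
  by (simp_all add: add_measure_def)

lemma emeasure_add_measure:
  assumes "sets N = sets M" "A \<in> sets M"
  shows "emeasure (add_measure M N) A = emeasure M A + emeasure N A"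
  unfolding add_measure_def
proof (rule emeasure_measure_of_sigma)
  show "sigma_algebra (space M) (sets M)" by (rule sets.sigma_algebra_axioms)
  show "positive (sets M) (\<lambda>A. emeasure M A + emeasure N A)"
    by (simp add: positive_def)
  show "countably_additive (sets M) (\<lambda>A. emeasure M A + emeasure N A)"
  proof (rule countably_additiveI)
    fix B :: "nat \<Rightarrow> _"
    assume "range B \<subseteq> sets M" "disjoint_family B"
    then show "(\<Sum>i. emeasure M (B i) + emeasure N (B i)) =
        emeasure M (\<Union>i. B i) + emeasure N (\<Union>i. B i)"
      using assms(1) by (simp add: suminf_add[symmetric] suminf_emeasure)
  qed
qed fact

definition spin_configs :: "('g::finite \<Rightarrow> nat) \<Rightarrow> ('g \<times> nat \<Rightarrow> real) set" where
  "spin_configs n = (SIGMA l:UNIV. {1..n l}) \<rightarrow>\<^sub>E {-1, 1}"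

definition gibbs_weight ::
    "real^'g^'g \<Rightarrow> ('g::finite \<Rightarrow> nat) \<Rightarrow> ('g \<times> nat \<Rightarrow> real) \<Rightarrow> real" where
  "gibbs_weight J n x =
     exp (1 / (2 * real (\<Sum>l\<in>UNIV. n l)) *
       (\<Sum>l\<in>UNIV. \<Sum>k\<in>UNIV. J $ l $ k * (\<Sum>i=1..n l. \<Sum>j=1..n k. x (l, i) * x (k, j))))"

definition partition_function :: "real^'g^'g \<Rightarrow> ('g::finite \<Rightarrow> nat) \<Rightarrow> real" where
  "partition_function J n = (\<Sum>x\<in>spin_configs n. gibbs_weight J n x)"

(* The spins X l i, for i = 1, ..., n l, are random variables on an arbitrary probability
   space P; only their joint law is prescribed. *)
definition curie_weiss_model ::
    "real^'g^'g \<Rightarrow> ('g::finite \<Rightarrow> nat) \<Rightarrow> 'a measure \<Rightarrow> ('g \<Rightarrow> nat \<Rightarrow> 'a \<Rightarrow> real) \<Rightarrow> bool" where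
  "curie_weiss_model J n P X \<longleftrightarrow>
     prob_space P \<and>
     (\<forall>l. \<forall>i\<in>{1..n l}. X l i \<in> borel_measurable P \<and> (\<forall>\<omega>\<in>space P. X l i \<omega> \<in> {-1, 1})) \<and>
     (\<forall>x\<in>spin_configs n.
        measure P {\<omega>\<in>space P. \<forall>l. \<forall>i\<in>{1..n l}. X l i \<omega> = x (l, i)} =
          gibbs_weight J n x / partition_function J n)"

(* The vector of per-group averages S_l / N_l. *)
definition magnetization ::
    "('g::finite \<Rightarrow> nat) \<Rightarrow> ('g \<Rightarrow> nat \<Rightarrow> 'a \<Rightarrow> real) \<Rightarrow> 'a \<Rightarrow> real^'g" where
  "magnetization n X \<omega> = (\<chi> l. (\<Sum>i=1..n l. X l i \<omega>) / real (n l))"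

definition cw_F :: "real^'g^'g \<Rightarrow> real^'g \<Rightarrow> real^'g \<Rightarrow> real" where
  "cw_F J \<alpha> y =
     1/2 * (\<Sum>l\<in>UNIV. \<Sum>k\<in>UNIV. matrix_inv J $ l $ k * y $ l * y $ k)
     - (\<Sum>l\<in>UNIV. \<alpha> $ l * ln (cosh (y $ l)))"

end

theory Submission
  imports Defs
begin

text \<open>Completing the square, the Gibbs weight is the Gaussian mixture
  \<open>\<integral>y. exp (- N/2 * (y \<bullet> (matrix_inv J *v y)) + y \<bullet> S)\<close> up to a constant factor, where \<open>S\<close> is the vector
  of group sums. Given \<open>y\<close> the spins are independent with means \<open>tanh (y $ l)\<close>, so \<open>S $ l / n l\<close>
  concentrates at \<open>tanh (y $ l)\<close> by Chebyshev's inequality, also when \<open>\<alpha> $ l = 0\<close>; and \<open>y\<close> has density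
  proportional to \<open>exp (- N * F y)\<close> with \<open>F = cw_F J (n / N)\<close>, so by Laplace's method it concentrates
  at the global minimizers of \<open>cw_F J \<alpha>\<close>. A critical point satisfies \<open>y = J *v w\<close> with
  \<open>w $ l = \<alpha> $ l * tanh (y $ l)\<close>, and replacing \<open>w\<close> by \<open>\<bar>w\<bar>\<close> decreases \<open>cw_F J \<alpha>\<close> unless \<open>w\<close> has
  constant sign. Low temperature excludes \<open>y = 0\<close>, so the minimizers lie in the positive and
  negative orthants, and spin-flip symmetry gives them equal mass.\<close>

subsection \<open>Positive definite matrices\<close>

text \<open>A vector in the kernel of \<open>J\<close> has quadratic form zero and so vanishes;
  hence \<open>J\<close> is injective and invertible. Both identities then come from the choice that
  defines \<open>matrix_inv\<close>.\<close>

lemma matrix_inv_mult_positive_definite: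
  fixes J :: "real^'n^'n"
  assumes "positive_definite J"
  shows "J ** matrix_inv J = mat 1" "matrix_inv J ** J = mat 1"
proof -
  have "inj ((*v) J)"
  proof (rule injI)
    fix x y assume "J *v x = J *v y"
    then have "(x - y) \<bullet> (J *v (x - y)) = 0"
      by (simp add: matrix_vector_mult_diff_distrib)
    then show "x = y"
      using assms unfolding positive_definite_def by (metis eq_iff_diff_eq_0 less_irrefl)
  qed
  then have "invertible J"
    by (metis invertible_left_inverse matrix_left_invertible_injective)
  then have "J ** matrix_inv J = mat 1 \<and> matrix_inv J ** J = mat 1"
    unfolding invertible_def matrix_inv_def by (rule someI_ex)
  then show "J ** matrix_inv J = mat 1" "matrix_inv J ** J = mat 1" by auto
qed

lemma matrix_inv_vector_cancel:
  fixes J :: "real^'n^'n"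
  assumes "positive_definite J"
  shows "J *v (matrix_inv J *v x) = x" "matrix_inv J *v (J *v x) = x"
  using matrix_inv_mult_positive_definite[OF assms] by (simp_all add: matrix_vector_mul_assoc)

lemma matrix_vector_mult_uminus: "(A::real^'n^'m) *v (- x) = - (A *v x)"
  by (simp add: matrix_vector_mult_def vec_eq_iff sum_negf)

lemma inner_symmetric_matrix:
  fixes J :: "real^'n^'n"
  assumes "transpose J = J"
  shows "x \<bullet> (J *v y) = (J *v x) \<bullet> y"
  using assms by (metis dot_lmul_matrix transpose_matrix_vector)

lemma inner_matrix_inv:
  fixes J :: "real^'n^'n"
  assumes "transpose J = J" "positive_definite J"
  shows "x \<bullet> (matrix_inv J *v y) = (matrix_inv J *v x) \<bullet> y"
  by (metis assms inner_symmetric_matrix matrix_inv_vector_cancel(1))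

text \<open>The constant is the minimum of the quadratic form on the compact unit sphere;
  homogeneity extends the bound to all vectors.\<close>

lemma positive_definite_coercive:
  fixes A :: "real^'n^'n"
  assumes "positive_definite A"
  obtains c where "c > 0" "\<And>x. x \<bullet> (A *v x) \<ge> c * (norm x)\<^sup>2"
proof -
  have "compact (sphere (0::real^'n) 1)" "sphere (0::real^'n) 1 \<noteq> {}" by auto
  moreover have "continuous_on (sphere 0 1) (\<lambda>x. x \<bullet> (A *v x))"
    by (intro continuous_intros matrix_vector_mult_linear_continuous_on)
  ultimately obtain u where u: "norm u = 1" "\<And>x. norm x = 1 \<Longrightarrow> u \<bullet> (A *v u) \<le> x \<bullet> (A *v x)"
    using continuous_attains_inf[of "sphere (0::real^'n) 1"] by force
  show ?thesis
  proof
    show "u \<bullet> (A *v u) > 0" using assms u(1) unfolding positive_definite_def by (metis norm_zero zero_neq_one)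
    fix x :: "real^'n"
    show "x \<bullet> (A *v x) \<ge> (u \<bullet> (A *v u)) * (norm x)\<^sup>2"
    proof (cases "x = 0")
      case False
      have "u \<bullet> (A *v u) \<le> (x /\<^sub>R norm x) \<bullet> (A *v (x /\<^sub>R norm x))"
        using False by (intro u) auto
      also have "\<dots> = (x \<bullet> (A *v x)) / (norm x)\<^sup>2"
        by (simp add: matrix_vector_mult_scaleR power2_eq_square divide_simps)
      finally show ?thesis using False by (simp add: field_simps)
    qed auto
  qed
qed

lemma positive_definite_matrix_inv:
  fixes J :: "real^'n^'n"
  assumes "transpose J = J" "positive_definite J"
  shows "positive_definite (matrix_inv J)"
  unfolding positive_definite_def
proof (intro allI impI)
  fix x :: "real^'n" assume "x \<noteq> 0"
  \<comment> \<open>In terms of \<open>z\<close> the form of the inverse at \<open>x\<close> is the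
    form of \<open>J\<close> at \<open>z\<close>.\<close>
  define z where "z = matrix_inv J *v x"
  have "x = J *v z" using matrix_inv_vector_cancel[OF assms(2)] by (simp add: z_def)
  then have "z \<noteq> 0" using \<open>x \<noteq> 0\<close> by auto
  then show "x \<bullet> (matrix_inv J *v x) > 0"
    using assms(2) \<open>x = J *v z\<close> unfolding positive_definite_def z_def[symmetric]
    by (simp add: inner_commute)
qed

subsection \<open>Minimizers of the free energy\<close>

lemma sum_sum_matrix_eq_inner:
  fixes A :: "real^'n^'n"
  shows "(\<Sum>l\<in>UNIV. \<Sum>k\<in>UNIV. A $ l $ k * (x $ l * y $ k)) = x \<bullet> (A *v y)"
  by (simp add: inner_vec_def matrix_vector_mult_def sum_distrib_left mult_ac)

lemma cw_F_eq: "cw_F J a y = y \<bullet> (matrix_inv J *v y) / 2 - (\<Sum>l\<in>UNIV. a $ l * ln (cosh (y $ l)))"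
  using sum_sum_matrix_eq_inner[of "matrix_inv J" y y] by (simp add: cw_F_def mult.assoc)

lemma cw_F_uminus: "cw_F J a (- y) = cw_F J a y"
  by (simp add: cw_F_eq matrix_vector_mult_uminus)

lemma continuous_on_cw_F: "continuous_on S (cw_F J a)"
  unfolding cw_F_eq [abs_def]
  by (intro continuous_intros matrix_vector_mult_linear_continuous_on) auto

section \<open>Convexity and growth of \<open>ln cosh\<close>, with the resulting bounds on
  \<open>cw_F\<close>\<close>

lemma ln_cosh_nonneg: "ln (cosh (x::real)) \<ge> 0"
  by (simp add: cosh_real_ge_1)

lemma ln_cosh_le_abs: "ln (cosh (x::real)) \<le> \<bar>x\<bar>"
proof -
  have "cosh x = (exp x + exp (- x)) / 2" by (simp add: cosh_field_def)
  also have "\<dots> \<le> (exp \<bar>x\<bar> + exp \<bar>x\<bar>) / 2"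
    by (intro divide_right_mono add_mono) auto
  finally show ?thesis 
    using ln_le_cancel_iff[of "cosh x" "exp \<bar>x\<bar>"] by simp
qed

lemma DERIV_ln_cosh: "((\<lambda>x::real. ln (cosh x)) has_real_derivative tanh x) (at x)"
  by (auto intro!: derivative_eq_intros simp: tanh_def field_simps)

text \<open>Convexity of \<open>ln cosh\<close>: by the mean value theorem the chord slope is
  \<open>tanh z\<close> at an intermediate \<open>z\<close>, and \<open>tanh\<close> is
  increasing.\<close>

lemma ln_cosh_ge_tangent: "ln (cosh (y::real)) \<ge> ln (cosh x) + tanh x * (y - x)"
proof -
  consider "x = y" | "x < y" | "y < x" by linarith
  then show ?thesis
  proof cases
    case 2
    then obtain z where z: "x < z" "z < y" "ln (cosh y) - ln (cosh x) = (y - x) * tanh z"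
      using MVT2[of x y "\<lambda>x. ln (cosh x)" tanh] DERIV_ln_cosh by blast
    then have "(y - x) * tanh x \<le> (y - x) * tanh z" by (intro mult_left_mono) auto
    with z show ?thesis by (simp add: algebra_simps)
  next
    case 3
    then obtain z where z: "y < z" "z < x" "ln (cosh x) - ln (cosh y) = (x - y) * tanh z"
      using MVT2[of y x "\<lambda>x. ln (cosh x)" tanh] DERIV_ln_cosh by blast
    then have "(x - y) * tanh z \<le> (x - y) * tanh x" by (intro mult_left_mono) auto
    with z show ?thesis by (simp add: algebra_simps)
  qed auto
qed

text \<open>Controls the passage from the finite proportions \<open>n / N\<close> to their limit:
  the error is uniform for \<open>y\<close> in bounded sets.\<close>

lemma cw_F_diff_bound:
  "\<bar>cw_F J a y - cw_F J b y\<bar> \<le> (\<Sum>l\<in>UNIV. \<bar>a $ l - b $ l\<bar>) * norm y"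
proof -
  have "\<bar>cw_F J a y - cw_F J b y\<bar> = \<bar>\<Sum>l\<in>UNIV. (b $ l - a $ l) * ln (cosh (y $ l))\<bar>"
    by (simp add: cw_F_eq sum_subtractf[symmetric] algebra_simps)
  also have "\<dots> \<le> (\<Sum>l\<in>UNIV. \<bar>(b $ l - a $ l) * ln (cosh (y $ l))\<bar>)" by (rule sum_abs)
  also have "\<dots> \<le> (\<Sum>l\<in>UNIV. \<bar>a $ l - b $ l\<bar> * norm y)"
  proof (rule sum_mono)
    fix l
    have "ln (cosh (y $ l)) \<le> norm y"
      using ln_cosh_le_abs[of "y $ l"] component_le_norm_cart[of y l] by linarith
    then show "\<bar>(b $ l - a $ l) * ln (cosh (y $ l))\<bar> \<le> \<bar>a $ l - b $ l\<bar> * norm y"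
      using ln_cosh_nonneg[of "y $ l"] by (simp add: abs_mult abs_minus_commute mult_left_mono)
  qed
  finally show ?thesis by (simp add: sum_distrib_right)
qed

text \<open>Comparison with the weights \<open>0\<close>, where only the quadratic form remains. The
  bound does not depend on \<open>a\<close>, so it serves all finite proportions
  simultaneously.\<close>

lemma cw_F_lower_bound:
  assumes "\<And>x. x \<bullet> (matrix_inv J *v x) \<ge> c * (norm x)\<^sup>2"
    and "\<And>l. a $ l \<ge> 0" "(\<Sum>l\<in>UNIV. a $ l) = 1"
  shows "cw_F J a y \<ge> c / 2 * (norm y)\<^sup>2 - norm y"
proof -
  have "\<bar>cw_F J a y - cw_F J 0 y\<bar> \<le> norm y"
    using cw_F_diff_bound[of J a y 0] assms by simp
  moreover have "cw_F J 0 y \<ge> c / 2 * (norm y)\<^sup>2"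
    using assms(1)[of y] by (simp add: cw_F_eq)
  ultimately show ?thesis by linarith
qed

section \<open>Existence, critical equation and sign pattern of global minimizers\<close>

lemma cw_F_minimizer_exists:
  assumes "transpose J = J" "positive_definite J" "\<And>l. a $ l \<ge> 0" "(\<Sum>l\<in>UNIV. a $ l) = 1"
  obtains y where "\<And>z. cw_F J a y \<le> cw_F J a z"
proof -
  obtain c where c: "c > 0" "\<And>x. x \<bullet> (matrix_inv J *v x) \<ge> c * (norm x)\<^sup>2"
    using positive_definite_coercive[OF positive_definite_matrix_inv[OF assms(1,2)]] by auto
  \<comment> \<open>Beyond this radius the lower bound \<open>c / 2 * r\<^sup>2 - r\<close> is
    nonnegative, hence at least the value of \<open>cw_F\<close> at \<open>0\<close>, so the minimum
    over the ball is global.\<close>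
  define R where "R = 2 / c"
  have "compact (cball (0::real^'a) R)" "cball (0::real^'a) R \<noteq> {}" using c by (auto simp: R_def)
  then obtain y where y: "\<And>z. norm z \<le> R \<Longrightarrow> cw_F J a y \<le> cw_F J a z"
    using continuous_attains_inf[OF _ _ continuous_on_cw_F, of "cball 0 R" J a] by force
  have "cw_F J a y \<le> cw_F J a z" for z
  proof (cases "norm z \<le> R")
    case False
    have "0 = cw_F J a 0" by (simp add: cw_F_eq)
    then have "cw_F J a y \<le> 0" using y[of 0] c by (simp add: R_def)
    also have "0 \<le> (c / 2 * norm z - 1) * norm z"
      using False c by (intro mult_nonneg_nonneg) (auto simp: R_def field_simps)
    also have "\<dots> \<le> cw_F J a z"
      using cw_F_lower_bound[OF c(2) assms(3,4), of z] by (simp add: power2_eq_square algebra_simps)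
    finally show ?thesis .
  qed (use y in auto)
  then show ?thesis using that by blast
qed

text \<open>Directional derivatives suffice for the first-order condition and for the instability of
  the origin. Symmetry of the inverse merges the two cross terms of the quadratic form.\<close>

lemma DERIV_cw_F_line:
  assumes "transpose J = J" "positive_definite J"
  shows "((\<lambda>t. cw_F J a (y + t *\<^sub>R v)) has_real_derivative
     v \<bullet> (matrix_inv J *v (y + t *\<^sub>R v)) - (\<Sum>l\<in>UNIV. a $ l * (tanh (y $ l + t * v $ l) * v $ l))) (at t)"
proof -
  let ?A = "matrix_inv J"
  have "(\<lambda>t. cw_F J a (y + t *\<^sub>R v)) = (\<lambda>t. (y \<bullet> (?A *v y) + 2 * t * (v \<bullet> (?A *v y)) + t\<^sup>2 * (v \<bullet> (?A *v v))) / 2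
      - (\<Sum>l\<in>UNIV. a $ l * ln (cosh (y $ l + t * v $ l))))"
    using inner_matrix_inv[OF assms, of y v]
    by (simp add: cw_F_eq fun_eq_iff algebra_simps power2_eq_square inner_commute)
  then show ?thesis
    by (auto intro!: derivative_eq_intros DERIV_ln_cosh[THEN DERIV_chain2] sum.cong
        simp: tanh_def matrix_vector_right_distrib matrix_vector_mult_scaleR inner_add_right field_simps)
qed

lemma cw_F_minimizer_critical:
  assumes "transpose J = J" "positive_definite J" "\<And>z. cw_F J a y \<le> cw_F J a z"
  shows "y = J *v (\<chi> l. a $ l * tanh (y $ l))"
proof -
  let ?w = "\<chi> l. a $ l * tanh (y $ l)"
  have "v \<bullet> (matrix_inv J *v y - ?w) = 0" for v
  proof -
    have "v \<bullet> (matrix_inv J *v (y + 0 *\<^sub>R v)) - (\<Sum>l\<in>UNIV. a $ l * (tanh (y $ l + 0 * v $ l) * v $ l)) = 0"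
      by (rule DERIV_local_min[OF DERIV_cw_F_line[OF assms(1,2)], of 1]) (use assms(3) in auto)
    then show ?thesis by (simp add: inner_diff_right inner_vec_def[of v ?w] mult_ac)
  qed
  then have "matrix_inv J *v y = ?w" by (metis inner_eq_zero_iff right_minus_eq)
  then show ?thesis using matrix_inv_vector_cancel(1)[OF assms(2), of y] by simp
qed

text \<open>Since \<open>tanh\<close> has derivative 1 at \<open>0\<close>, the matrix in the
  assumption is the Hessian at the origin; a direction of negative curvature leads downhill.\<close>

lemma zero_not_cw_F_minimizer:
  assumes "transpose J = J" "positive_definite J"
    and "\<not> positive_semidefinite (matrix_inv J - diagonal_matrix a)"
  shows "\<exists>z. cw_F J a z < cw_F J a 0"
proof -
  let ?A = "matrix_inv J"
  obtain v where v: "v \<bullet> ((?A - diagonal_matrix a) *v v) < 0"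
    using assms(3) by (auto simp: positive_semidefinite_def not_le)
  \<comment> \<open>The derivative of \<open>cw_F\<close> along the ray through \<open>v\<close>. It
    vanishes at \<open>0\<close> and has negative slope there, so it is negative just to the right
    of \<open>0\<close>.\<close>
  define \<psi> where "\<psi> t = t * (v \<bullet> (?A *v v)) - (\<Sum>l\<in>UNIV. a $ l * (tanh (t * v $ l) * v $ l))" for t
  have "diagonal_matrix a *v v = (\<chi> l. a $ l * v $ l)"
    by (simp add: diagonal_matrix_def matrix_vector_mult_def vec_eq_iff if_distrib[of "\<lambda>x. x * _"] cong: if_cong)
  then have "v \<bullet> (diagonal_matrix a *v v) = (\<Sum>l\<in>UNIV. a $ l * (v $ l * v $ l))"
    by (simp only: inner_vec_def vec_lambda_beta inner_real_def ac_simps)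
  then have neg: "v \<bullet> (?A *v v) - (\<Sum>l\<in>UNIV. a $ l * (v $ l * v $ l)) < 0"
    using v by (simp add: matrix_vector_mult_diff_rdistrib inner_diff_right)
  have "(\<psi> has_real_derivative v \<bullet> (?A *v v) - (\<Sum>l\<in>UNIV. a $ l * (v $ l * v $ l))) (at 0)"
    unfolding \<psi>_def by (auto intro!: derivative_eq_intros simp: ac_simps)
  from DERIV_neg_dec_right[OF this neg] obtain d where d: "d > 0" "\<And>h. 0 < h \<Longrightarrow> h < d \<Longrightarrow> \<psi> h < \<psi> 0"
    by auto
  have \<psi>: "((\<lambda>t. cw_F J a (0 + t *\<^sub>R v)) has_real_derivative \<psi> t) (at t)" for t
    using DERIV_cw_F_line[OF assms(1,2), of a 0 v t] by (simp add: \<psi>_def matrix_vector_mult_scaleR)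
  have "cw_F J a (0 + 0 *\<^sub>R v) > cw_F J a (0 + (d/2) *\<^sub>R v)"
  proof (rule DERIV_neg_imp_decreasing_open[where f = "\<lambda>t. cw_F J a (0 + t *\<^sub>R v)"])
    show "continuous_on {0..d/2} (\<lambda>t. cw_F J a (0 + t *\<^sub>R v))"
      using \<psi> by (meson DERIV_isCont continuous_at_imp_continuous_on)
    show "\<exists>y. DERIV (\<lambda>t. cw_F J a (0 + t *\<^sub>R v)) t :> y \<and> y < 0" if "0 < t" "t < d/2" for t
      using \<psi>[of t] d(2)[of t] that d(1) by (auto simp: \<psi>_def)
  qed (use d in auto)
  then show ?thesis by auto
qed

text \<open>The inverse of a matrix with positive entries may have off-diagonal entries of either sign,
  so \<open>cw_F\<close> itself need not decrease under \<open>y \<mapsto> \<bar>y\<bar>\<close>. Instead, the absolute value is taken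
  in the dual variable \<open>w = matrix_inv J *v y\<close>.\<close>

lemma cw_F_minimizer_orthant:
  fixes J :: "real^'n^'n"
  assumes J: "transpose J = J" "positive_definite J" "\<And>l k. J $ l $ k > 0"
    and a: "\<And>l. a $ l \<ge> 0"
    and y: "\<And>z. cw_F J a y \<le> cw_F J a z" and "y \<noteq> 0"
  shows "(\<forall>l. y $ l > 0) \<or> (\<forall>l. y $ l < 0)"
proof -
  define w where "w = (\<chi> l. a $ l * tanh (y $ l))"
  define w' where "w' = (\<chi> l. \<bar>w $ l\<bar>)"
  define y' where "y' = J *v w'"
  have yw: "y = J *v w" using cw_F_minimizer_critical[OF J(1,2) y] by (simp add: w_def)
  have F: "cw_F J a (J *v u) = u \<bullet> (J *v u) / 2 - (\<Sum>l\<in>UNIV. a $ l * ln (cosh ((J *v u) $ l)))" for u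
    by (simp add: cw_F_eq matrix_inv_vector_cancel[OF J(2)] inner_commute)
  \<comment> \<open>The tangent at \<open>\<bar>y $ l\<bar>\<close>, evaluated at
    \<open>y' $ l\<close> and weighted by \<open>a $ l\<close>. As \<open>cosh\<close> is even and
    \<open>tanh\<close> odd, the coefficients are exactly those of \<open>w'\<close> and
    \<open>w\<close>.\<close>
  have tangent: "(\<Sum>l\<in>UNIV. a $ l * ln (cosh (y' $ l))) \<ge>
      (\<Sum>l\<in>UNIV. a $ l * ln (cosh (y $ l))) + w' \<bullet> y' - w \<bullet> y"
  proof -
    have "a $ l * ln (cosh (y $ l)) + w' $ l * y' $ l - w $ l * y $ l \<le> a $ l * ln (cosh (y' $ l))" for l
    proof -
      have "\<bar>tanh (y $ l)\<bar> * \<bar>y $ l\<bar> = tanh (y $ l) * y $ l"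
        by (cases "y $ l" "0::real" rule: linorder_cases)
          (simp_all add: abs_mult_pos abs_of_neg)
      moreover have "w' $ l = a $ l * \<bar>tanh (y $ l)\<bar>" using a by (simp add: w'_def w_def abs_mult)
      moreover have "a $ l * ln (cosh (y' $ l)) \<ge> a $ l * (ln (cosh \<bar>y $ l\<bar>) + tanh \<bar>y $ l\<bar> * (y' $ l - \<bar>y $ l\<bar>))"
        by (intro mult_left_mono ln_cosh_ge_tangent a)
      ultimately show ?thesis by (simp add: w_def algebra_simps)
    qed
    then have "(\<Sum>l\<in>UNIV. a $ l * ln (cosh (y $ l)) + w' $ l * y' $ l - w $ l * y $ l) \<le>
       (\<Sum>l\<in>UNIV. a $ l * ln (cosh (y' $ l)))" by (rule sum_mono)
    then show ?thesis by (simp add: sum.distrib sum_subtractf inner_vec_def)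
  qed
  have "cw_F J a y \<le> cw_F J a y'" by (rule y)
  \<comment> \<open>The tangent bound gives \<open>cw_F J a y' \<le> cw_F J a y + (w \<bullet> y -
    w' \<bullet> y') / 2\<close>, which minimality of \<open>y\<close> turns into this
    inequality.\<close>
  then have le: "w' \<bullet> (J *v w') \<le> w \<bullet> (J *v w)"
    using tangent unfolding y'_def yw F by simp
  \<comment> \<open>Because \<open>J\<close> has positive entries, taking absolute values decreases
    no term of the form and strictly increases one with opposite signs, contradicting
    \<open>le\<close>.\<close>
  have signs: "w $ l * w $ k \<ge> 0" for l k
  proof (rule ccontr)
    assume neg: "\<not> w $ l * w $ k \<ge> 0"
    have "(\<Sum>p\<in>UNIV. J $ fst p $ snd p * (w $ fst p * w $ snd p)) <
        (\<Sum>p\<in>UNIV. J $ fst p $ snd p * (w' $ fst p * w' $ snd p))"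
    proof (rule sum_strict_mono_ex1)
      show "\<forall>p\<in>UNIV. J $ fst p $ snd p * (w $ fst p * w $ snd p)
          \<le> J $ fst p $ snd p * (w' $ fst p * w' $ snd p)"
        using J(3) by (auto intro!: mult_left_mono less_imp_le[OF J(3)] simp: w'_def abs_mult[symmetric])
      show "\<exists>p\<in>UNIV. J $ fst p $ snd p * (w $ fst p * w $ snd p)
          < J $ fst p $ snd p * (w' $ fst p * w' $ snd p)"
        using neg J(3)[of l k] by (intro bexI[of _ "(l,k)"]) (auto simp: w'_def abs_mult[symmetric] not_le mult_pos_neg
          intro: order_less_le_trans[of _ 0])
    qed simp
    then have "w \<bullet> (J *v w) < w' \<bullet> (J *v w')"
      by (simp add: sum_sum_matrix_eq_inner[symmetric] sum.cartesian_product case_prod_beta)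
    with le show False by simp
  qed
  \<comment> \<open>Upgrades weak signs of \<open>w\<close> to strict signs of \<open>y\<close>,
    including the coordinates where \<open>a $ l = 0\<close> forces
    \<open>w $ l = 0\<close>.\<close>
  have pos: "(J *v u) $ l > 0" if u: "\<And>l. u $ l \<ge> 0" "u \<noteq> 0" for u l
  proof -
    obtain k where "u $ k \<noteq> 0" using u(2) by (auto simp: vec_eq_iff)
    then have "u $ k > 0" using u(1)[of k] by simp
    then have "0 < (\<Sum>k\<in>UNIV. J $ l $ k * u $ k)"
      using J(3) u(1) by (intro sum_pos2[of _ k]) (auto intro: mult_nonneg_nonneg less_imp_le)
    then show ?thesis by (simp add: matrix_vector_mult_def)
  qed
  have "w \<noteq> 0" using yw \<open>y \<noteq> 0\<close> by auto
  then obtain k where "w $ k \<noteq> 0" by (auto simp: vec_eq_iff)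
  then consider "w $ k > 0" | "w $ k < 0" by linarith
  then show ?thesis
  proof cases
    case 1
    then have "w $ l \<ge> 0" for l using signs[of l k] by (simp add: zero_le_mult_iff)
    then show ?thesis using pos[of w] \<open>w \<noteq> 0\<close> yw by auto
  next
    case 2
    then have "(- w) $ l \<ge> 0" for l using signs[of l k] by (simp add: zero_le_mult_iff)
    then have "(J *v (- w)) $ l > 0" for l using pos[of "- w"] \<open>w \<noteq> 0\<close> by auto
    then show ?thesis using yw by (simp add: matrix_vector_mult_uminus)
  qed
qed

subsection \<open>Laplace's method\<close>

text \<open>The integrand factorizes over the coordinates, each factor being a multiple of a normal
  density of variance \<open>1 / (2 * k)\<close>.\<close>

lemma integrable_gaussian_norm:
  assumes "k > 0"
  shows "integrable lborel (\<lambda>y::'a::euclidean_space. exp (- k * (norm y)\<^sup>2))"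
proof (rule integrableI_nonneg)
  have "(\<lambda>x. exp (- k * x\<^sup>2)) = (\<lambda>x. sqrt (pi / k) * normal_density 0 (sqrt (1 / (2 * k))) x)"
    using assms by (simp add: normal_density_def fun_eq_iff real_sqrt_divide field_simps)
  moreover have "integrable lborel (normal_density 0 (sqrt (1 / (2 * k))))" using assms by simp
  ultimately have "integrable lborel (\<lambda>x. exp (- k * x\<^sup>2))" by simp
  then have fin: "(\<integral>\<^sup>+x. ennreal (exp (- k * x\<^sup>2)) \<partial>lborel) < \<infinity>"
    by (simp add: integrable_iff_bounded)
  have "(norm y)\<^sup>2 = (\<Sum>b\<in>Basis. (y \<bullet> b)\<^sup>2)" for y :: 'a
    unfolding power2_norm_eq_inner by (subst euclidean_inner) (simp add: power2_eq_square)
  then have "(\<integral>\<^sup>+y. ennreal (exp (- k * (norm (y::'a))\<^sup>2)) \<partial>lborel) =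
      (\<integral>\<^sup>+y. (\<Prod>b\<in>Basis. ennreal (exp (- k * ((y::'a) \<bullet> b)\<^sup>2))) \<partial>lborel)"
    by (simp add: prod_ennreal exp_sum[symmetric] sum_distrib_left sum_negf)
  also have "\<dots> = (\<Prod>b\<in>(Basis::'a set). \<integral>\<^sup>+x. ennreal (exp (- k * x\<^sup>2)) \<partial>lborel)"
    by (intro nn_integral_lborel_prod) auto
  also have "\<dots> < \<infinity>" using fin by (simp add: less_top[symmetric] power_eq_top_ennreal)
  finally show "(\<integral>\<^sup>+y. ennreal (exp (- k * (norm (y::'a))\<^sup>2)) \<partial>lborel) < \<infinity>" .
qed auto

text \<open>Completing the square, half of the quadratic term absorbs the linear one at the cost of
  a constant factor.\<close>

lemma integrable_exp_linear_minus_quadratic: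
  assumes "k > 0"
  shows "integrable lborel (\<lambda>y::'a::euclidean_space. exp (b * norm y - k * (norm y)\<^sup>2))"
proof (rule Bochner_Integration.integrable_bound)
  show "integrable lborel (\<lambda>y::'a. exp (b\<^sup>2 / (2 * k)) * exp (- (k/2) * (norm y)\<^sup>2))"
    using assms by (intro integrable_mult_right integrable_gaussian_norm) auto
  have "b * t - k * t\<^sup>2 \<le> b\<^sup>2 / (2 * k) - (k/2) * t\<^sup>2" for t
  proof -
    have "0 \<le> (b - k * t)\<^sup>2 / (2 * k)" using assms by simp
    also have "\<dots> = b\<^sup>2 / (2 * k) - (k/2) * t\<^sup>2 - (b * t - k * t\<^sup>2)"
      using assms by (simp add: field_simps power2_eq_square)
    finally show ?thesis by simp
  qed
  then show "AE y in lborel. norm (exp (b * norm (y::'a) - k * (norm y)\<^sup>2))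
      \<le> norm (exp (b\<^sup>2 / (2 * k)) * exp (- (k/2) * (norm y)\<^sup>2))"
    by (simp add: exp_add[symmetric])
qed simp

lemma integrable_exp_cw_F:
  assumes "transpose J = J" "positive_definite J" "\<And>l. a $ l \<ge> 0" "(\<Sum>l\<in>UNIV. a $ l) = 1" "r > 0"
  shows "integrable lborel (\<lambda>y. exp (- r * cw_F J a y))"
proof -
  obtain c where c: "c > 0" "\<And>x. x \<bullet> (matrix_inv J *v x) \<ge> c * (norm x)\<^sup>2"
    using positive_definite_coercive[OF positive_definite_matrix_inv[OF assms(1,2)]] by auto
  show ?thesis
  proof (rule Bochner_Integration.integrable_bound)
    show "integrable lborel (\<lambda>y::real^'a. exp (r * norm y - (r * c / 2) * (norm y)\<^sup>2))"
      using c assms by (intro integrable_exp_linear_minus_quadratic) auto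
    have "r * (c / 2 * (norm y)\<^sup>2 - norm y) \<le> r * cw_F J a y" for y
      using cw_F_lower_bound[OF c(2) assms(3,4), of y] assms(5) by (intro mult_left_mono) auto
    then show "AE y in lborel. norm (exp (- r * cw_F J a y)) \<le> norm (exp (r * norm y - (r * c / 2) * (norm y)\<^sup>2))"
      by (simp add: algebra_simps)
    have "continuous_on UNIV (\<lambda>y. exp (- r * cw_F J a y))"
      by (intro continuous_intros continuous_on_cw_F)
    then show "(\<lambda>y. exp (- r * cw_F J a y)) \<in> borel_measurable lborel"
      by (simp add: borel_measurable_continuous_onI)
  qed
qed

text \<open>On a ball, compactness gives a gap for the limiting weights and convergence transfers
  it; outside, the quadratic growth is uniform in \<open>N\<close>.\<close>

lemma cw_F_uniform_lower_bound:
  fixes J :: "real^'n^'n"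
  assumes J: "transpose J = J" "positive_definite J"
    and a: "\<And>l. a $ l \<ge> 0" "(\<Sum>l\<in>UNIV. a $ l) = 1"
    and b: "\<And>N l. N > 0 \<Longrightarrow> b N $ l \<ge> 0" "\<And>N. N > 0 \<Longrightarrow> (\<Sum>l\<in>UNIV. b N $ l) = 1"
    and lim: "\<And>l. (\<lambda>N::nat. b N $ l) \<longlonglongrightarrow> a $ l"
    and K: "closed K" "\<And>y. y \<in> K \<Longrightarrow> F0 < cw_F J a y"
  obtains \<eta> where "\<eta> > 0" "\<forall>\<^sub>F N in sequentially. \<forall>y\<in>K. cw_F J (b N) y \<ge> F0 + \<eta>"
proof -
  obtain c where c: "c > 0" "\<And>x. x \<bullet> (matrix_inv J *v x) \<ge> c * (norm x)\<^sup>2"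
    using positive_definite_coercive[OF positive_definite_matrix_inv[OF J]] by auto
  \<comment> \<open>Outside this radius the growth bound yields at least
    \<open>\<bar>F0\<bar> + 1\<close>, which exceeds \<open>F0 + \<eta>\<close> once
    \<open>\<eta> \<le> 1\<close>.\<close>
  define R where "R = max 1 (2 / c * (\<bar>F0\<bar> + 2))"
  \<comment> \<open>The gap is taken as \<open>2 * \<eta>\<close>, since replacing \<open>a\<close>
    by \<open>b N\<close> inside the ball costs up to \<open>\<eta>\<close>.\<close>
  have "\<exists>\<eta>>0. \<eta> \<le> 1 \<and> (\<forall>y\<in>K \<inter> cball 0 R. cw_F J a y \<ge> F0 + 2 * \<eta>)"
  proof (cases "K \<inter> cball 0 R = {}")
    case False
    have "compact (K \<inter> cball 0 R)" using K(1) by (intro closed_Int_compact) auto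
    from continuous_attains_inf[OF this False continuous_on_cw_F, of J a]
    obtain z where z: "z \<in> K" "\<And>y. y \<in> K \<inter> cball 0 R \<Longrightarrow> cw_F J a z \<le> cw_F J a y" by auto
    show ?thesis
    proof (intro exI[of _ "min 1 ((cw_F J a z - F0) / 2)"] conjI ballI)
      show "F0 + 2 * min 1 ((cw_F J a z - F0) / 2) \<le> cw_F J a y" if "y \<in> K \<inter> cball 0 R" for y
        using z(2)[OF that] by (simp add: min_def field_simps)
    qed (use K(2)[OF z(1)] in auto)
  qed (auto intro: exI[of _ 1])
  then obtain \<eta> where \<eta>: "\<eta> > 0" "\<eta> \<le> 1" "\<And>y. y \<in> K \<Longrightarrow> norm y \<le> R \<Longrightarrow> cw_F J a y \<ge> F0 + 2 * \<eta>"
    by auto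
  have "(\<lambda>N. \<Sum>l\<in>UNIV. \<bar>b N $ l - a $ l\<bar>) \<longlonglongrightarrow> (\<Sum>l\<in>UNIV. \<bar>a $ l - a $ l\<bar>)"
    by (intro tendsto_intros lim)
  then have "\<forall>\<^sub>F N in sequentially. (\<Sum>l\<in>UNIV. \<bar>b N $ l - a $ l\<bar>) < \<eta> / R"
    using \<eta>(1) by (intro order_tendstoD) (auto simp: R_def)
  then have "\<forall>\<^sub>F N in sequentially. \<forall>y\<in>K. cw_F J (b N) y \<ge> F0 + \<eta>"
    using eventually_gt_at_top[of 0]
  proof eventually_elim
    case (elim N)
    show ?case
    proof
      fix y assume y: "y \<in> K"
      show "F0 + \<eta> \<le> cw_F J (b N) y"
      proof (cases "norm y \<le> R")
        case True
        have "(\<Sum>l\<in>UNIV. \<bar>b N $ l - a $ l\<bar>) * norm y \<le> \<eta> / R * R"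
          using elim True \<eta>(1) by (intro mult_mono) (auto simp: R_def intro: sum_nonneg)
        also have "\<dots> = \<eta>" by (simp add: R_def)
        finally show ?thesis using cw_F_diff_bound[of J "b N" y a] \<eta>(3)[OF y True] by linarith
      next
        case False
        then have "norm y \<ge> 1" "2 / c * (\<bar>F0\<bar> + 2) \<le> norm y" by (auto simp: R_def)
        then have "\<bar>F0\<bar> + 2 \<le> c / 2 * norm y" using c by (simp add: field_simps)
        then have "(\<bar>F0\<bar> + 1) * 1 \<le> (c / 2 * norm y - 1) * norm y"
          using \<open>norm y \<ge> 1\<close> by (intro mult_mono) auto
        also have "\<dots> \<le> cw_F J (b N) y"
          using cw_F_lower_bound[OF c(2) b[OF elim(2)], of y] by (simp add: power2_eq_square algebra_simps)
        finally show ?thesis using \<eta>(2) abs_ge_self[of F0] by simp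
      qed
    qed
  qed
  then show ?thesis using that \<eta>(1) by blast
qed

text \<open>The integral over \<open>K\<close> is at most of order
  \<open>exp (- N * (F0 + \<eta>))\<close>, while a small ball around \<open>m\<close> alone
  contributes order \<open>exp (- N * (F0 + \<eta> / 2))\<close>; here \<open>F0\<close> is the
  value at \<open>m\<close>. The ratio decays like \<open>exp (- N * \<eta> / 2)\<close>.\<close>

lemma laplace_concentration:
  fixes J :: "real^'n^'n"
  assumes J: "transpose J = J" "positive_definite J"
    and a: "\<And>l. a $ l \<ge> 0" "(\<Sum>l\<in>UNIV. a $ l) = 1"
    and b: "\<And>N l. N > 0 \<Longrightarrow> b N $ l \<ge> 0" "\<And>N. N > 0 \<Longrightarrow> (\<Sum>l\<in>UNIV. b N $ l) = 1"
    and lim: "\<And>l. (\<lambda>N::nat. b N $ l) \<longlonglongrightarrow> a $ l"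
    and K: "closed K" "\<And>y. y \<in> K \<Longrightarrow> cw_F J a m < cw_F J a y"
    and "\<epsilon> > 0"
  shows "\<forall>\<^sub>F N in sequentially. (\<integral>y. indicator K y * exp (- real N * cw_F J (b N) y) \<partial>lborel)
      \<le> \<epsilon> * (\<integral>y. exp (- real N * cw_F J (b N) y) \<partial>lborel)"
proof -
  let ?F0 = "cw_F J a m"
  obtain c where c: "c > 0" "\<And>x. x \<bullet> (matrix_inv J *v x) \<ge> c * (norm x)\<^sup>2"
    using positive_definite_coercive[OF positive_definite_matrix_inv[OF J]] by auto
  obtain \<eta> where \<eta>: "\<eta> > 0" "\<forall>\<^sub>F N in sequentially. \<forall>y\<in>K. cw_F J (b N) y \<ge> ?F0 + \<eta>"
    using cw_F_uniform_lower_bound[OF J a b lim K] by blast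
  define C where "C = (\<integral>y. exp (norm (y::real^'n) - c / 2 * (norm y)\<^sup>2) \<partial>lborel)"
  have C: "integrable lborel (\<lambda>y::real^'n. exp (norm y - c / 2 * (norm y)\<^sup>2))"
    using integrable_exp_linear_minus_quadratic[of "c/2" 1] c by simp
  have "isCont (cw_F J a) m"
    using continuous_on_cw_F[of UNIV J a] by (simp add: continuous_on_eq_continuous_at)
  \<comment> \<open>Continuity uses \<open>\<eta> / 4\<close>; the change of weights from
    \<open>a\<close> to \<open>b N\<close> uses the other \<open>\<eta> / 4\<close> in
    \<open>near\<close>.\<close>
  then obtain \<rho> where \<rho>: "\<rho> > 0" "\<And>y. dist y m < \<rho> \<Longrightarrow> dist (cw_F J a y) ?F0 < \<eta> / 4"
    using \<eta>(1) unfolding continuous_at_eps_delta by (metis zero_less_divide_iff zero_less_numeral)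
  define U where "U = ball m \<rho>"
  define V where "V = measure lborel U"
  have V: "V > 0" using \<rho>(1) by (simp add: V_def U_def content_ball_pos)
  have U: "U \<in> sets lborel" "emeasure lborel U < \<infinity>" by (use emeasure_lborel_ball_finite[of m \<rho>] in \<open>auto simp: U_def\<close>)
  have meas: "(\<lambda>y. cw_F J (b N) y) \<in> borel_measurable borel" for N
    by (simp add: borel_measurable_continuous_onI continuous_on_cw_F)
  have KM: "K \<in> sets borel" using K(1) by simp
  have near: "\<forall>\<^sub>F N in sequentially. \<forall>y\<in>U. cw_F J (b N) y \<le> ?F0 + \<eta> / 2"
  proof -
    have "(\<lambda>N. (\<Sum>l\<in>UNIV. \<bar>b N $ l - a $ l\<bar>) * (norm m + \<rho>)) \<longlonglongrightarrow> (\<Sum>l\<in>UNIV. \<bar>a $ l - a $ l\<bar>) * (norm m + \<rho>)"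
      by (intro tendsto_intros lim)
    then have "\<forall>\<^sub>F N in sequentially. (\<Sum>l\<in>UNIV. \<bar>b N $ l - a $ l\<bar>) * (norm m + \<rho>) < \<eta> / 4"
      using \<eta>(1) by (intro order_tendstoD) auto
    then show ?thesis
    proof eventually_elim
      case (elim N)
      show ?case
      proof
        fix y assume "y \<in> U"
        then have y: "dist y m < \<rho>" by (simp add: U_def dist_commute)
        then have "norm y \<le> norm m + \<rho>" using norm_triangle_sub[of y m] by (simp add: dist_norm)
        then have "(\<Sum>l\<in>UNIV. \<bar>b N $ l - a $ l\<bar>) * norm y \<le> (\<Sum>l\<in>UNIV. \<bar>b N $ l - a $ l\<bar>) * (norm m + \<rho>)"
          by (intro mult_left_mono) (auto intro: sum_nonneg)
        then show "cw_F J (b N) y \<le> ?F0 + \<eta> / 2"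
          using cw_F_diff_bound[of J "b N" y a] elim \<rho>(2)[OF y]
          unfolding dist_real_def abs_le_iff abs_less_iff by linarith
      qed
    qed
  qed
  have "(\<lambda>N. exp (- real N * (\<eta> / 2))) \<longlonglongrightarrow> 0"
  proof -
    have "(\<lambda>N. exp (- (\<eta> / 2)) ^ N) \<longlonglongrightarrow> 0" using \<eta>(1) by (intro LIMSEQ_power_zero) auto
    then show ?thesis by (simp add: exp_of_nat_mult[symmetric])
  qed
  then have "(\<lambda>N. exp (?F0 + \<eta>) * C / V * exp (- real N * (\<eta> / 2))) \<longlonglongrightarrow> exp (?F0 + \<eta>) * C / V * 0"
    by (intro tendsto_intros)
  then have "\<forall>\<^sub>F N in sequentially. exp (?F0 + \<eta>) * C / V * exp (- real N * (\<eta> / 2)) < \<epsilon>"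
    using \<open>\<epsilon> > 0\<close> by (intro order_tendstoD) auto
  then show ?thesis using \<eta>(2) near eventually_gt_at_top[of 0]
  proof eventually_elim
    case (elim N)
    let ?G = "\<lambda>y. exp (- real N * cw_F J (b N) y)"
    have int: "integrable lborel ?G"
      using integrable_exp_cw_F[OF J b[OF elim(4)], of "real N"] elim(4) by simp
    have "exp (- real N * (?F0 + \<eta> / 2)) * V = (\<integral>y. exp (- real N * (?F0 + \<eta> / 2)) * indicator U y \<partial>lborel)"
      using U by (simp add: V_def)
    also have "\<dots> \<le> (\<integral>y. ?G y \<partial>lborel)"
    proof (rule integral_mono)
      show "integrable lborel (\<lambda>y. exp (- real N * (?F0 + \<eta> / 2)) * indicator U y)"
        using U by (intro integrable_mult_right) auto
      show "exp (- real N * (?F0 + \<eta> / 2)) * indicator U y \<le> ?G y" for y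
        using elim(3,4) by (auto simp: indicator_def)
    qed (rule int)
    finally have lower: "exp (- real N * (?F0 + \<eta> / 2)) * V \<le> (\<integral>y. ?G y \<partial>lborel)" .
    \<comment> \<open>Of the \<open>N\<close> factors \<open>exp (- cw_F J (b N) y)\<close>, one is
      kept to make the integral over the possibly unbounded \<open>K\<close> finite; the other
      \<open>N - 1\<close> are estimated by the gap.\<close>
    have "(\<integral>y. indicator K y * ?G y \<partial>lborel)
       \<le> (\<integral>y. exp (- (real N - 1) * (?F0 + \<eta>)) * exp (norm (y::real^'n) - c / 2 * (norm y)\<^sup>2) \<partial>lborel)"
    proof (rule integral_mono)
      show "integrable lborel (\<lambda>y. indicator K y * ?G y)"
        using integrable_mult_indicator[OF _ int, of K] KM by simp
      show "integrable lborel (\<lambda>y. exp (- (real N - 1) * (?F0 + \<eta>)) * exp (norm (y::real^'n) - c / 2 * (norm y)\<^sup>2))"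
        using C by (rule integrable_mult_right)
      show "indicator K y * ?G y \<le> exp (- (real N - 1) * (?F0 + \<eta>)) * exp (norm y - c / 2 * (norm y)\<^sup>2)" for y
      proof (cases "y \<in> K")
        case True
        have "(real N - 1) * (?F0 + \<eta>) \<le> (real N - 1) * cw_F J (b N) y"
          using elim(2,4) True by (intro mult_left_mono) auto
        moreover have "c / 2 * (norm y)\<^sup>2 - norm y \<le> cw_F J (b N) y"
          using cw_F_lower_bound[OF c(2) b[OF elim(4)]] .
        ultimately show ?thesis using True by (simp add: exp_add[symmetric] algebra_simps)
      qed auto
    qed
    also have "\<dots> = exp (- (real N - 1) * (?F0 + \<eta>)) * C" by (simp add: C_def)
    also have "\<dots> = (exp (?F0 + \<eta>) * C / V * exp (- real N * (\<eta> / 2))) * (exp (- real N * (?F0 + \<eta> / 2)) * V)"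
      using V by (simp add: field_simps exp_add[symmetric] exp_minus_inverse)
    also have "\<dots> \<le> \<epsilon> * (\<integral>y. ?G y \<partial>lborel)"
      using elim(1) lower V \<open>\<epsilon> > 0\<close> by (intro mult_mono) auto
    finally show ?case .
  qed
qed

subsection \<open>Exponentially tilted spins\<close>

abbreviation spin_sites :: "('g \<Rightarrow> nat) \<Rightarrow> ('g \<times> nat) set" where
  "spin_sites n \<equiv> SIGMA l:UNIV. {1..n l}"

definition spin_sum :: "('g::finite \<Rightarrow> nat) \<Rightarrow> ('g \<times> nat \<Rightarrow> real) \<Rightarrow> real^'g" where
  "spin_sum n x = (\<chi> l. \<Sum>i=1..n l. x (l, i))"

definition spin_mean :: "('g::finite \<Rightarrow> nat) \<Rightarrow> ('g \<times> nat \<Rightarrow> real) \<Rightarrow> real^'g" where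
  "spin_mean n x = (\<chi> l. spin_sum n x $ l / real (n l))"

lemma finite_spin_sites: "finite (spin_sites (n :: 'g::finite \<Rightarrow> nat))"
  by auto

lemma finite_spin_configs: "finite (spin_configs n)"
  unfolding spin_configs_def by (intro finite_PiE) auto

lemma spin_configs_nonempty: "spin_configs n \<noteq> {}"
  by (auto simp: spin_configs_def PiE_eq_empty_iff)

lemma inner_spin_sum: "y \<bullet> spin_sum n x = (\<Sum>p\<in>spin_sites n. y $ fst p * x p)"
proof -
  have "y \<bullet> spin_sum n x = (\<Sum>l\<in>UNIV. \<Sum>i=1..n l. y $ l * x (l, i))"
    by (simp add: inner_vec_def spin_sum_def sum_distrib_left)
  also have "\<dots> = (\<Sum>p\<in>spin_sites n. y $ fst p * x p)"
    by (subst sum.Sigma) (auto simp: case_prod_beta)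
  finally show ?thesis .
qed

text \<open>The weight is a quadratic exponential in the group sums alone, the form that a Gaussian
  integral can linearize.\<close>

lemma gibbs_weight_eq:
  "gibbs_weight J n x = exp (1 / (2 * real (\<Sum>l\<in>UNIV. n l)) * (spin_sum n x \<bullet> (J *v spin_sum n x)))"
  by (simp add: gibbs_weight_def sum_sum_matrix_eq_inner[symmetric] spin_sum_def sum_product)

text \<open>Independence under the tilted weights: a sum of products over configurations is a
  product over sites. The site functions \<open>h\<close> allow both the normalizing constant and
  covariances to be read off.\<close>

lemma sum_exp_spin:
  "(\<Sum>x\<in>spin_configs n. \<Prod>p\<in>spin_sites n. h p (x p) * exp (y $ fst p * x p)) =
   (\<Prod>p\<in>spin_sites n. h p 1 * exp (y $ fst p) + h p (- 1) * exp (- (y $ fst p)))"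
proof -
  have "(\<Prod>p\<in>spin_sites n. \<Sum>s\<in>{- 1, 1}. h p s * exp (y $ fst p * s)) =
    (\<Sum>x\<in>spin_configs n. \<Prod>p\<in>spin_sites n. h p (x p) * exp (y $ fst p * x p))"
    unfolding spin_configs_def by (rule prod_sum_PiE) auto
  then show ?thesis by (simp add: add.commute)
qed

lemma exp_inner_spin_sum:
  "exp (y \<bullet> spin_sum n x) = (\<Prod>p\<in>spin_sites n. exp (y $ fst p * x p))"
  unfolding inner_spin_sum by (intro exp_sum finite_spin_sites)

text \<open>Each site contributes \<open>2 * cosh (y $ l)\<close>, written as an exponential to
  match the logarithmic term of \<open>cw_F\<close>.\<close>

lemma sum_exp_inner_spin_sum:
  "(\<Sum>x\<in>spin_configs n. exp (y \<bullet> spin_sum n x)) =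
     exp (\<Sum>l\<in>UNIV. real (n l) * (ln 2 + ln (cosh (y $ l))))"
proof -
  have "(\<Sum>x\<in>spin_configs n. exp (y \<bullet> spin_sum n x)) =
      (\<Prod>p\<in>spin_sites n. exp (y $ fst p) + exp (- (y $ fst p)))"
    using sum_exp_spin[of "\<lambda>_ _. 1" y n] by (simp add: exp_inner_spin_sum)
  also have "\<dots> = (\<Prod>p\<in>spin_sites n. exp (ln 2 + ln (cosh (y $ fst p))))"
  proof (intro prod.cong refl)
    show "exp (y $ fst p) + exp (- (y $ fst p)) = exp (ln 2 + ln (cosh (y $ fst p)))" for p :: "'a \<times> nat"
    proof -
      have "exp (ln 2 + ln (cosh (y $ fst p))) = 2 * cosh (y $ fst p)" by (simp add: exp_add)
      then show ?thesis by (simp add: cosh_field_def)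
    qed
  qed
  also have "\<dots> = exp (\<Sum>p\<in>spin_sites n. ln 2 + ln (cosh (y $ fst p)))"
    by (intro exp_sum[symmetric] finite_spin_sites)
  also have "(\<Sum>p\<in>spin_sites n. ln 2 + ln (cosh (y $ fst p))) = (\<Sum>l\<in>UNIV. real (n l) * (ln 2 + ln (cosh (y $ l))))"
    using sum.Sigma[of UNIV "\<lambda>l. {1..n l}" "\<lambda>l i. ln 2 + ln (cosh (y $ l))"]
    by (simp add: case_prod_beta)
  finally show ?thesis .
qed

text \<open>Under the weights \<open>exp (y \<bullet> spin_sum n x)\<close> the spins are independent with means \<open>tanh (y $ l)\<close>,
  so the off-diagonal covariances vanish.\<close>

lemma spin_covariance_zero:
  assumes "p \<in> spin_sites n" "q \<in> spin_sites n" "p \<noteq> q"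
  shows "(\<Sum>x\<in>spin_configs n. (x p - tanh (y $ fst p)) * (x q - tanh (y $ fst q)) * exp (y \<bullet> spin_sum n x)) = 0"
proof -
  \<comment> \<open>Inserts the centred spins at \<open>p\<close> and \<open>q\<close> and the
    constant 1 elsewhere.\<close>
  let ?h = "\<lambda>r s. if r = p \<or> r = q then s - tanh (y $ fst r) else 1"
  have "(\<Prod>r\<in>spin_sites n. ?h r (x r)) = (x p - tanh (y $ fst p)) * (x q - tanh (y $ fst q))" for x
  proof -
    have "(\<Prod>r\<in>spin_sites n. ?h r (x r)) = (\<Prod>r\<in>{p, q}. ?h r (x r))"
      by (rule prod.mono_neutral_right) (use assms finite_spin_sites in auto)
    then show ?thesis using assms(3) by simp
  qed
  then have "(\<Sum>x\<in>spin_configs n. (x p - tanh (y $ fst p)) * (x q - tanh (y $ fst q)) * exp (y \<bullet> spin_sum n x))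
      = (\<Sum>x\<in>spin_configs n. \<Prod>r\<in>spin_sites n. ?h r (x r) * exp (y $ fst r * x r))"
    by (simp add: exp_inner_spin_sum prod.distrib)
  also have "\<dots> = (\<Prod>r\<in>spin_sites n. ?h r 1 * exp (y $ fst r) + ?h r (- 1) * exp (- (y $ fst r)))"
    by (rule sum_exp_spin)
  also have "\<dots> = 0"
  proof (rule prod_zero)
    \<comment> \<open>A centred spin has tilted mean zero, so the factor at site \<open>p\<close>
      kills the product.\<close>
    have "(1 - tanh t) * exp t + (- 1 - tanh t) * exp (- t) = 0" for t :: real
    proof -
      have "tanh t * cosh t = sinh t" by (simp add: tanh_def)
      then show ?thesis by (simp add: cosh_field_def sinh_field_def field_simps)
    qed
    then show "\<exists>r\<in>spin_sites n. ?h r 1 * exp (y $ fst r) + ?h r (- 1) * exp (- (y $ fst r)) = 0"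
      using assms(1) by (intro bexI[of _ p]) auto
  qed (rule finite_spin_sites)
  finally show ?thesis .
qed

text \<open>Only the \<open>n l\<close> diagonal terms of the expanded square survive, and a centred
  spin is at most 2 in absolute value.\<close>

lemma spin_sum_variance:
  "(\<Sum>x\<in>spin_configs n. (spin_sum n x $ l - real (n l) * tanh (y $ l))\<^sup>2 * exp (y \<bullet> spin_sum n x))
    \<le> 4 * real (n l) * (\<Sum>x\<in>spin_configs n. exp (y \<bullet> spin_sum n x))"
proof -
  let ?t = "tanh (y $ l)" and ?W = "\<lambda>x. exp (y \<bullet> spin_sum n x)" and ?S = "spin_configs n"
  have "(\<Sum>x\<in>?S. (spin_sum n x $ l - real (n l) * ?t)\<^sup>2 * ?W x)
     = (\<Sum>x\<in>?S. (\<Sum>i=1..n l. \<Sum>j=1..n l. (x (l,i) - ?t) * (x (l,j) - ?t) * ?W x))"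
  proof (rule sum.cong)
    fix x
    have "spin_sum n x $ l - real (n l) * ?t = (\<Sum>i=1..n l. x (l,i) - ?t)"
      by (simp add: spin_sum_def sum_subtractf)
    then have "(spin_sum n x $ l - real (n l) * ?t)\<^sup>2 = (\<Sum>i=1..n l. \<Sum>j=1..n l. (x (l,i) - ?t) * (x (l,j) - ?t))"
      by (simp only: power2_eq_square sum_product)
    then show "(spin_sum n x $ l - real (n l) * ?t)\<^sup>2 * ?W x
        = (\<Sum>i=1..n l. \<Sum>j=1..n l. (x (l,i) - ?t) * (x (l,j) - ?t) * ?W x)"
      by (simp only: sum_distrib_right)
  qed simp
  also have "\<dots> = (\<Sum>i=1..n l. \<Sum>j=1..n l. \<Sum>x\<in>?S. (x (l,i) - ?t) * (x (l,j) - ?t) * ?W x)"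
    by (subst sum.swap, rule sum.cong, rule refl, rule sum.swap)
  also have "\<dots> = (\<Sum>i=1..n l. \<Sum>j=1..n l. if i = j then \<Sum>x\<in>?S. (x (l,i) - ?t)\<^sup>2 * ?W x else 0)"
    using spin_covariance_zero[of "(l, _)" n "(l, _)" y]
    by (intro sum.cong refl) (auto simp: power2_eq_square)
  also have "\<dots> = (\<Sum>i=1..n l. \<Sum>x\<in>?S. (x (l,i) - ?t)\<^sup>2 * ?W x)"
    by simp
  also have "\<dots> \<le> (\<Sum>i=1..n l. \<Sum>x\<in>?S. 4 * ?W x)"
  proof (intro sum_mono mult_right_mono)
    fix i x assume "i \<in> {1..n l}" "x \<in> ?S"
    then have "x (l,i) \<in> {- 1, 1}" by (auto simp: spin_configs_def PiE_iff)
    then have "\<bar>x (l,i) - ?t\<bar> \<le> 2"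
      using tanh_real_lt_1[of "y $ l"] tanh_real_gt_neg1[of "y $ l"] by (auto simp: abs_le_iff)
    then have "(x (l,i) - ?t)\<^sup>2 \<le> 2\<^sup>2" by (metis abs_le_square_iff abs_numeral)
    then show "(x (l,i) - ?t)\<^sup>2 \<le> 4" by simp
  qed simp
  finally show ?thesis by (simp add: sum_distrib_left mult.assoc mult.left_commute[of 4])
qed

text \<open>Splits the error at \<open>tanh (y $ l)\<close> into fluctuation and bias. The
  fluctuation term is \<open>2 * (4 * n l) / (n l)\<^sup>2\<close>, small whenever the group is
  large, whatever its proportion.\<close>

lemma spin_mean_second_moment:
  fixes m y :: "real^'g" and n :: "'g::finite \<Rightarrow> nat"
  assumes n: "\<And>l. n l > 0"
  shows "(\<Sum>x\<in>spin_configs n. (norm (spin_mean n x - m))\<^sup>2 * exp (y \<bullet> spin_sum n x))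
    \<le> (\<Sum>l\<in>UNIV. 8 / real (n l) + 2 * (tanh (y $ l) - m $ l)\<^sup>2) * (\<Sum>x\<in>spin_configs n. exp (y \<bullet> spin_sum n x))"
proof -
  let ?W = "\<lambda>x. exp (y \<bullet> spin_sum n x)" and ?S = "spin_configs n"
  have "(norm (spin_mean n x - m))\<^sup>2 \<le>
     (\<Sum>l\<in>UNIV. 2 / (real (n l))\<^sup>2 * (spin_sum n x $ l - real (n l) * tanh (y $ l))\<^sup>2 + 2 * (tanh (y $ l) - m $ l)\<^sup>2)" for x
  proof -
    have "(norm (spin_mean n x - m))\<^sup>2 = (\<Sum>l\<in>UNIV. (spin_mean n x $ l - m $ l)\<^sup>2)"
      unfolding power2_norm_eq_inner inner_vec_def by (simp add: power2_eq_square)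
    also have "\<dots> \<le> (\<Sum>l\<in>UNIV. 2 / (real (n l))\<^sup>2 * (spin_sum n x $ l - real (n l) * tanh (y $ l))\<^sup>2 + 2 * (tanh (y $ l) - m $ l)\<^sup>2)"
    proof (rule sum_mono)
      fix l
      have "(u - w)\<^sup>2 \<le> 2 * (u - v)\<^sup>2 + 2 * (v - w)\<^sup>2" for u v w :: real
      proof -
        have "2 * (u - v)\<^sup>2 + 2 * (v - w)\<^sup>2 - (u - w)\<^sup>2 = ((u - v) - (v - w))\<^sup>2"
          by (simp add: power2_eq_square algebra_simps)
        then show ?thesis using zero_le_power2[of "(u - v) - (v - w)"] by linarith
      qed
      from this[of "spin_mean n x $ l" "m $ l" "tanh (y $ l)"]
      show "(spin_mean n x $ l - m $ l)\<^sup>2 \<le> 2 / (real (n l))\<^sup>2 * (spin_sum n x $ l - real (n l) * tanh (y $ l))\<^sup>2 + 2 * (tanh (y $ l) - m $ l)\<^sup>2"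
        using n[of l]
        by (simp add: spin_mean_def divide_diff_eq_iff power_divide mult.commute[of _ "real (n l)"])
    qed
    finally show ?thesis .
  qed
  then have "(\<Sum>x\<in>?S. (norm (spin_mean n x - m))\<^sup>2 * ?W x) \<le>
     (\<Sum>x\<in>?S. (\<Sum>l\<in>UNIV. 2 / (real (n l))\<^sup>2 * (spin_sum n x $ l - real (n l) * tanh (y $ l))\<^sup>2 + 2 * (tanh (y $ l) - m $ l)\<^sup>2) * ?W x)"
    by (intro sum_mono mult_right_mono) auto
  also have "\<dots> = (\<Sum>l\<in>UNIV. 2 / (real (n l))\<^sup>2 * (\<Sum>x\<in>?S. (spin_sum n x $ l - real (n l) * tanh (y $ l))\<^sup>2 * ?W x)
      + 2 * (tanh (y $ l) - m $ l)\<^sup>2 * (\<Sum>x\<in>?S. ?W x))"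
    unfolding sum_distrib_right by (subst sum.swap) (simp add: sum_distrib_left sum.distrib distrib_right mult.assoc)
  also have "\<dots> \<le> (\<Sum>l\<in>UNIV. 2 / (real (n l))\<^sup>2 * (4 * real (n l) * (\<Sum>x\<in>?S. ?W x))
      + 2 * (tanh (y $ l) - m $ l)\<^sup>2 * (\<Sum>x\<in>?S. ?W x))"
    by (intro sum_mono add_right_mono mult_left_mono spin_sum_variance) auto
  also have "\<dots> = (\<Sum>l\<in>UNIV. (8 / real (n l) + 2 * (tanh (y $ l) - m $ l)\<^sup>2) * (\<Sum>x\<in>?S. ?W x))"
  proof (intro sum.cong refl)
    fix l
    show "2 / (real (n l))\<^sup>2 * (4 * real (n l) * (\<Sum>x\<in>?S. ?W x)) + 2 * (tanh (y $ l) - m $ l)\<^sup>2 * (\<Sum>x\<in>?S. ?W x)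
        = (8 / real (n l) + 2 * (tanh (y $ l) - m $ l)\<^sup>2) * (\<Sum>x\<in>?S. ?W x)"
      using n[of l] by (simp add: field_simps power2_eq_square)
  qed
  finally show ?thesis by (simp add: sum_distrib_right)
qed

subsection \<open>Hubbard-Stratonovich transformation\<close>

text \<open>The exponent is a centred quadratic form in \<open>c + y\<close> plus a constant, and
  Lebesgue measure is translation invariant.\<close>

lemma hubbard_stratonovich:
  fixes J :: "real^'n^'n"
  assumes J: "transpose J = J" "positive_definite J" and "r > 0"
  shows "integrable lborel (\<lambda>y. exp (- r / 2 * (y \<bullet> (matrix_inv J *v y)) + y \<bullet> s))"
    and "(\<integral>y. exp (- r / 2 * (y \<bullet> (matrix_inv J *v y)) + y \<bullet> s) \<partial>lborel) =
      (\<integral>y. exp (- r / 2 * (y \<bullet> (matrix_inv J *v y))) \<partial>lborel) * exp (1 / (2 * r) * (s \<bullet> (J *v s)))"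
proof -
  let ?A = "matrix_inv J"
  let ?G = "\<lambda>y. exp (- r / 2 * (y \<bullet> (?A *v y)))"
  define c where "c = - (1 / r) *\<^sub>R (J *v s)"
  obtain k where k: "k > 0" "\<And>x. x \<bullet> (?A *v x) \<ge> k * (norm x)\<^sup>2"
    using positive_definite_coercive[OF positive_definite_matrix_inv[OF J]] by auto
  have cont: "continuous_on UNIV ?G"
    by (intro continuous_intros matrix_vector_mult_linear_continuous_on)
  then have meas: "?G \<in> borel_measurable borel" by (rule borel_measurable_continuous_onI)
  have int: "integrable lborel ?G"
  proof (rule Bochner_Integration.integrable_bound)
    show "integrable lborel (\<lambda>y::real^'n. exp (- (r / 2 * k) * (norm y)\<^sup>2))"
      using k \<open>r > 0\<close> by (intro integrable_gaussian_norm) auto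
    show "AE y in lborel. norm (?G y) \<le> norm (exp (- (r / 2 * k) * (norm y)\<^sup>2))"
      using k(2) \<open>r > 0\<close> by (auto simp: mult.assoc intro!: mult_left_mono)
  qed (use meas in simp)
  have square: "exp (- r / 2 * (y \<bullet> (?A *v y)) + y \<bullet> s) = exp (1 / (2 * r) * (s \<bullet> (J *v s))) * ?G (c + y)" for y
  proof -
    have Ac: "?A *v c = - (1 / r) *\<^sub>R s"
      unfolding c_def matrix_vector_mult_scaleR matrix_inv_vector_cancel[OF J(2)] ..
    have "(c + y) \<bullet> (?A *v (c + y)) = c \<bullet> (?A *v c) + 2 * (y \<bullet> (?A *v c)) + y \<bullet> (?A *v y)"
      using inner_matrix_inv[OF J, of c y] by (simp add: algebra_simps inner_commute)
    also have "\<dots> = (s \<bullet> (J *v s)) / r\<^sup>2 - 2 / r * (y \<bullet> s) + y \<bullet> (?A *v y)"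
      unfolding Ac by (simp add: c_def inner_commute power2_eq_square)
    finally show ?thesis
      using \<open>r > 0\<close> by (simp add: exp_add[symmetric] field_simps power2_eq_square)
  qed
  have "integrable (distr lborel borel ((+) c)) ?G" using int unfolding lborel_distr_plus .
  then have "integrable lborel (\<lambda>y. ?G (c + y))"
    using meas by (subst (asm) integrable_distr_eq) auto
  then show "integrable lborel (\<lambda>y. exp (- r / 2 * (y \<bullet> (?A *v y)) + y \<bullet> s))"
    unfolding square by (rule integrable_mult_right)
  have "integral\<^sup>L lborel ?G = integral\<^sup>L (distr lborel borel ((+) c)) ?G" unfolding lborel_distr_plus ..
  also have "\<dots> = (\<integral>y. ?G (c + y) \<partial>lborel)" using meas by (subst integral_distr) auto
  finally show "(\<integral>y. exp (- r / 2 * (y \<bullet> (?A *v y)) + y \<bullet> s) \<partial>lborel) =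
      integral\<^sup>L lborel ?G * exp (1 / (2 * r) * (s \<bullet> (J *v s)))"
    unfolding square by simp
qed

subsection \<open>Weak convergence of the magnetization\<close>

text \<open>The restriction sets the value to \<open>undefined\<close> off the sites, as membership
  in the extensional product \<open>spin_configs\<close> demands.\<close>

definition spin_config :: "('g::finite \<Rightarrow> nat) \<Rightarrow> ('g \<Rightarrow> nat \<Rightarrow> 'a \<Rightarrow> real) \<Rightarrow> 'a \<Rightarrow> 'g \<times> nat \<Rightarrow> real" where
  "spin_config n X \<omega> = restrict (\<lambda>p. X (fst p) (snd p) \<omega>) (spin_sites n)"

lemma magnetization_eq_spin_mean: "magnetization n X \<omega> = spin_mean n (spin_config n X \<omega>)"
proof -
  have "(\<Sum>i=1..n l. X l i \<omega>) = (\<Sum>i=1..n l. spin_config n X \<omega> (l, i))" for l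
    by (intro sum.cong refl) (auto simp: spin_config_def)
  then show ?thesis by (simp add: magnetization_def spin_mean_def spin_sum_def)
qed

text \<open>The events of the individual configurations partition the space, so the integrand is a
  finite sum of indicators and only the prescribed joint law enters.\<close>

lemma curie_weiss_expectation:
  fixes f :: "real^'g \<Rightarrow> real" and n :: "'g::finite \<Rightarrow> nat"
  assumes model: "curie_weiss_model J n P X" and f: "continuous_on UNIV f"
  shows "(\<integral>z. f z \<partial>distr P borel (magnetization n X)) =
    (\<Sum>x\<in>spin_configs n. f (spin_mean n x) * gibbs_weight J n x) / partition_function J n"
proof -
  interpret prob_space P using model by (simp add: curie_weiss_model_def)
  have X[measurable]: "X l i \<in> borel_measurable P" if "i \<in> {1..n l}" for l i
    using model that by (auto simp: curie_weiss_model_def)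
  let ?E = "\<lambda>x. {\<omega>\<in>space P. \<forall>l. \<forall>i\<in>{1..n l}. X l i \<omega> = x (l, i)}"
  have E[measurable]: "?E x \<in> sets P" for x
  proof -
    have "{\<omega>\<in>space P. \<forall>l\<in>UNIV. \<forall>i\<in>{1..n l}. X l i \<omega> = x (l, i)} \<in> sets P"
      using X by (intro sets.sets_Collect_finite_All sets.sets_Collect_finite_All' borel_measurable_eq) auto
    then show ?thesis by simp
  qed
  have mag: "magnetization n X \<in> borel_measurable P"
  proof -
    have "(\<lambda>\<omega>. magnetization n X \<omega> \<bullet> b) \<in> borel_measurable P" if b: "b \<in> Basis" for b
    proof -
      obtain l where "b = axis l 1" using b by (auto simp: Basis_vec_def)
      then have "(\<lambda>\<omega>. magnetization n X \<omega> \<bullet> b) = (\<lambda>\<omega>. (\<Sum>i=1..n l. X l i \<omega>) / real (n l))"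
        by (simp add: inner_axis magnetization_def)
      then show ?thesis using X by simp
    qed
    then show ?thesis by (subst borel_measurable_euclidean_space) auto
  qed
  have "(\<integral>z. f z \<partial>distr P borel (magnetization n X)) = (\<integral>\<omega>. f (magnetization n X \<omega>) \<partial>P)"
    using mag f by (intro integral_distr borel_measurable_continuous_onI)
  also have "\<dots> = (\<integral>\<omega>. (\<Sum>x\<in>spin_configs n. f (spin_mean n x) * indicator (?E x) \<omega>) \<partial>P)"
  proof (rule Bochner_Integration.integral_cong[OF refl])
    fix \<omega> assume \<omega>: "\<omega> \<in> space P"
    let ?c = "spin_config n X \<omega>"
    have "X l i \<omega> \<in> {- 1, 1}" if "i \<in> {1..n l}" for l i
      using model \<omega> that unfolding curie_weiss_model_def by blast
    then have c: "?c \<in> spin_configs n"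
      by (fastforce simp: spin_configs_def spin_config_def)
    have "\<omega> \<in> ?E x \<longleftrightarrow> x = ?c" if x: "x \<in> spin_configs n" for x
    proof
      assume "\<omega> \<in> ?E x"
      moreover have "?c p = undefined" "x p = undefined" if "p \<notin> spin_sites n" for p
        using c x that unfolding spin_configs_def by (blast intro: PiE_arb)+
      ultimately have "x p = ?c p" for p
        by (cases "p \<in> spin_sites n") (auto simp: spin_config_def)
      then show "x = ?c" by (rule ext)
    qed (use \<omega> in \<open>auto simp: spin_config_def\<close>)
    then have "(\<Sum>x\<in>spin_configs n. f (spin_mean n x) * indicator (?E x) \<omega>)
        = (\<Sum>x\<in>spin_configs n. if x = ?c then f (spin_mean n x) else 0)"
      by (intro sum.cong refl) (auto simp: indicator_def)
    also have "\<dots> = f (spin_mean n ?c)"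
      using c unfolding sum.delta[OF finite_spin_configs] by (rule if_P)
    finally show "f (magnetization n X \<omega>) = (\<Sum>x\<in>spin_configs n. f (spin_mean n x) * indicator (?E x) \<omega>)"
      by (simp add: magnetization_eq_spin_mean)
  qed
  also have "\<dots> = (\<Sum>x\<in>spin_configs n. f (spin_mean n x) * measure P (?E x))"
    using E by (subst Bochner_Integration.integral_sum) (auto simp: emeasure_eq_measure)
  also have "\<dots> = (\<Sum>x\<in>spin_configs n. f (spin_mean n x) * (gibbs_weight J n x / partition_function J n))"
    using model by (intro sum.cong refl) (simp add: curie_weiss_model_def)
  finally show ?thesis by (simp add: sum_divide_distrib)
qed

section \<open>Gibbs averages as ratios of integrals over the mixing variable
  \<open>y\<close>\<close>

lemma partition_function_pos: "partition_function J n > 0"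
  unfolding partition_function_def
  by (intro sum_pos finite_spin_configs spin_configs_nonempty) (simp add: gibbs_weight_def)

text \<open>The global spin flip is an involution of the configurations that negates the group sums
  and preserves their quadratic form.\<close>

lemma sum_spin_configs_flip:
  "(\<Sum>x\<in>spin_configs n. f (spin_mean n x) * gibbs_weight J n x) =
   (\<Sum>x\<in>spin_configs n. f (- spin_mean n x) * gibbs_weight J n x)"
proof -
  define flip where "flip x = restrict (\<lambda>p. - x p) (spin_sites n)" for x :: "'a \<times> nat \<Rightarrow> real"
  have flip_in: "flip x \<in> spin_configs n" if "x \<in> spin_configs n" for x
    using that by (auto simp: flip_def spin_configs_def PiE_iff)
  have flip_flip: "flip (flip x) = x" if "x \<in> spin_configs n" for x
  proof
    show "flip (flip x) p = x p" for p
      using that by (cases p; cases "p \<in> spin_sites n") (auto simp: flip_def spin_configs_def PiE_def extensional_def)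
  qed
  have s: "spin_sum n (flip x) = - spin_sum n x" for x
    by (simp add: spin_sum_def vec_eq_iff flip_def sum_negf[symmetric])
  then have "spin_mean n (flip x) = - spin_mean n x" for x
    by (simp add: spin_mean_def vec_eq_iff)
  moreover have "gibbs_weight J n (flip x) = gibbs_weight J n x" for x
    by (simp add: gibbs_weight_eq s matrix_vector_mult_uminus)
  ultimately show ?thesis
    by (intro sum.reindex_bij_witness[of _ flip flip]) (auto simp: flip_in flip_flip)
qed

text \<open>Linearizes each weight with \<open>r = N\<close>. The Gaussian prefactor is the same for
  every \<open>h\<close>, so it cancels against the case \<open>h = 1\<close>, the partition
  function.\<close>

lemma gibbs_sum_integral:
  fixes J :: "real^'g^'g" and n :: "'g::finite \<Rightarrow> nat"
  assumes J: "transpose J = J" "positive_definite J" and N: "(\<Sum>l\<in>UNIV. n l) = N" "N > 0"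
  shows "integrable lborel (\<lambda>y. \<Sum>x\<in>spin_configs n. h x * exp (- real N / 2 * (y \<bullet> (matrix_inv J *v y)) + y \<bullet> spin_sum n x))"
    and "(\<integral>y. (\<Sum>x\<in>spin_configs n. h x * exp (- real N / 2 * (y \<bullet> (matrix_inv J *v y)) + y \<bullet> spin_sum n x)) \<partial>lborel)
      = (\<integral>y. exp (- real N / 2 * (y \<bullet> (matrix_inv J *v y))) \<partial>lborel) * (\<Sum>x\<in>spin_configs n. h x * gibbs_weight J n x)"
proof -
  note HS = hubbard_stratonovich[OF J, of "real N"]
  have int: "integrable lborel (\<lambda>y. h x * exp (- real N / 2 * (y \<bullet> (matrix_inv J *v y)) + y \<bullet> spin_sum n x))" for x
    using HS(1)[of "spin_sum n x"] N by (intro integrable_mult_right) auto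
  then show "integrable lborel (\<lambda>y. \<Sum>x\<in>spin_configs n. h x * exp (- real N / 2 * (y \<bullet> (matrix_inv J *v y)) + y \<bullet> spin_sum n x))"
    by (rule Bochner_Integration.integrable_sum)
  show "(\<integral>y. (\<Sum>x\<in>spin_configs n. h x * exp (- real N / 2 * (y \<bullet> (matrix_inv J *v y)) + y \<bullet> spin_sum n x)) \<partial>lborel)
      = (\<integral>y. exp (- real N / 2 * (y \<bullet> (matrix_inv J *v y))) \<partial>lborel) * (\<Sum>x\<in>spin_configs n. h x * gibbs_weight J n x)"
    unfolding Bochner_Integration.integral_sum[OF int] integral_mult_right_zero gibbs_weight_eq N(1)
    using N(2) by (simp only: HS(2) of_nat_0_less_iff sum_distrib_left mult.left_commute)
qed

text \<open>Summing out the spins leaves the unnormalized density of the mixing variable, to which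
  Laplace's method applies.\<close>

lemma sum_spin_weights_eq_cw_F:
  assumes N: "(\<Sum>l\<in>UNIV. n l) = N" "N > 0"
  shows "(\<Sum>x\<in>spin_configs n. exp (- real N / 2 * (y \<bullet> (matrix_inv J *v y)) + y \<bullet> spin_sum n x))
    = 2 ^ N * exp (- real N * cw_F J (\<chi> l. real (n l) / real N) y)"
proof -
  have "(\<Sum>l\<in>UNIV. real (n l) * (ln 2 + ln (cosh (y $ l)))) =
      real N * ln 2 + (\<Sum>l\<in>UNIV. real (n l) * ln (cosh (y $ l)))"
    using N(1) by (simp add: distrib_left sum.distrib sum_distrib_right[symmetric] flip: of_nat_sum)
  moreover have "(\<Sum>l\<in>UNIV. real (n l) * ln (cosh (y $ l))) =
      real N * (\<Sum>l\<in>UNIV. real (n l) / real N * ln (cosh (y $ l)))"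
    using N(2) by (simp add: sum_distrib_left)
  moreover have "(2::real) ^ N = exp (real N * ln 2)" by (simp add: exp_of_nat_mult)
  moreover have "(\<Sum>x\<in>spin_configs n. exp (- real N / 2 * (y \<bullet> (matrix_inv J *v y)) + y \<bullet> spin_sum n x))
     = exp (- real N / 2 * (y \<bullet> (matrix_inv J *v y))) * (\<Sum>x\<in>spin_configs n. exp (y \<bullet> spin_sum n x))"
    by (simp only: exp_add sum_distrib_left)
  ultimately show ?thesis
    by (simp add: sum_exp_inner_spin_sum cw_F_eq exp_add[symmetric] algebra_simps)
qed

text \<open>The Chebyshev device: continuity handles \<open>z\<close> near \<open>m\<close>, and at
  distance at least \<open>\<rho>\<close> the trivial bound \<open>2 * B\<close> is below a multiple
  of the squared distance.\<close>

lemma bounded_continuous_quadratic_bound: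
  fixes h :: "'a::real_normed_vector \<Rightarrow> real"
  assumes "continuous_on UNIV h" "\<And>z. \<bar>h z\<bar> \<le> B" "\<epsilon> > 0"
  obtains M where "M \<ge> 0" "\<And>z. \<bar>h z - h m\<bar> \<le> \<epsilon> + M * (norm (z - m))\<^sup>2"
proof -
  obtain \<rho> where \<rho>: "\<rho> > 0" "\<And>z. dist z m < \<rho> \<Longrightarrow> dist (h z) (h m) < \<epsilon>"
    using assms(1,3) unfolding continuous_on_iff by (metis UNIV_I)
  have B: "B \<ge> 0" using assms(2)[of m] by linarith
  show ?thesis
  proof
    show "2 * B / \<rho>\<^sup>2 \<ge> 0" using B by simp
    fix z
    show "\<bar>h z - h m\<bar> \<le> \<epsilon> + 2 * B / \<rho>\<^sup>2 * (norm (z - m))\<^sup>2"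
    proof (cases "dist z m < \<rho>")
      case True
      then have "\<bar>h z - h m\<bar> \<le> \<epsilon>" using \<rho>(2)[of z] by (simp add: dist_real_def)
      moreover have "0 \<le> 2 * B / \<rho>\<^sup>2 * (norm (z - m))\<^sup>2" using B by simp
      ultimately show ?thesis by linarith
    next
      case False
      then have "\<rho>\<^sup>2 \<le> (norm (z - m))\<^sup>2" using \<rho>(1) by (intro power_mono) (auto simp: dist_norm)
      then have "2 * B / \<rho>\<^sup>2 * \<rho>\<^sup>2 \<le> 2 * B / \<rho>\<^sup>2 * (norm (z - m))\<^sup>2" using B by (intro mult_left_mono) auto
      then show ?thesis using \<rho>(1) assms(2)[of z] assms(2)[of m] \<open>\<epsilon> > 0\<close>
        by (simp add: abs_le_iff)
    qed
  qed
qed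

text \<open>An even \<open>h\<close> takes the same value at both limit points, so the split of mass
  between them is irrelevant. Away from \<open>K\<close> the second moment controls the error; on
  \<open>K\<close> the mixing density is negligible.\<close>

lemma gibbs_even_limit:
  fixes J :: "real^'g^'g" and n :: "nat \<Rightarrow> 'g::finite \<Rightarrow> nat" and h :: "real^'g \<Rightarrow> real"
  assumes J: "transpose J = J" "positive_definite J"
    and a: "\<And>l. a $ l \<ge> 0" "(\<Sum>l\<in>UNIV. a $ l) = 1"
    and n: "\<And>N. (\<Sum>l\<in>UNIV. n N l) = N" "\<And>l. filterlim (\<lambda>N. n N l) at_top sequentially"
      "\<And>l. (\<lambda>N. real (n N l) / real N) \<longlonglongrightarrow> a $ l"
    and min: "\<And>y. y \<noteq> u \<Longrightarrow> y \<noteq> - u \<Longrightarrow> cw_F J a u < cw_F J a y"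
    and h: "continuous_on UNIV h" "\<And>z. \<bar>h z\<bar> \<le> B" "\<And>z. h (- z) = h z"
  shows "(\<lambda>N. (\<Sum>x\<in>spin_configs (n N). h (spin_mean (n N) x) * gibbs_weight J (n N) x) / partition_function J (n N))
     \<longlonglongrightarrow> h (\<chi> l. tanh (u $ l))"
proof (rule LIMSEQ_I)
  fix \<epsilon>' :: real assume "\<epsilon>' > 0"
  define m where "m = (\<chi> l. tanh (u $ l))"
  have B: "B \<ge> 0" using h(2)[of 0] by linarith
  \<comment> \<open>Chosen so that the total error \<open>\<epsilon> * (1 + 2 * B)\<close> equals
    \<open>\<epsilon>' / 2\<close>.\<close>
  define \<epsilon> where "\<epsilon> = \<epsilon>' / (2 * (1 + 2 * B))"
  have \<epsilon>: "\<epsilon> > 0" using \<open>\<epsilon>' > 0\<close> B by (simp add: \<epsilon>_def)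
  obtain M where M: "M \<ge> 0" "\<And>z. \<bar>h z - h m\<bar> \<le> \<epsilon> / 2 + M * (norm (z - m))\<^sup>2"
    using bounded_continuous_quadratic_bound[OF h(1,2), of "\<epsilon> / 2"] \<epsilon> by (metis half_gt_zero)
  \<comment> \<open>The \<open>y\<close> whose bias term with respect to \<open>v\<close> costs less
    than \<open>\<epsilon> / 4\<close>. Since \<open>u\<close> lies in \<open>V m\<close> and
    \<open>- u\<close> in \<open>V (- m)\<close>, the complement \<open>K\<close> avoids both
    minimizers.\<close>
  define V where "V v = {y. M * (\<Sum>l\<in>UNIV. 2 * (tanh (y $ l) - v $ l)\<^sup>2) < \<epsilon> / 4}" for v :: "real^'g"
  define K where "K = - (V m \<union> V (- m))"
  have "open (V v)" for v
    unfolding V_def by (intro open_Collect_less continuous_intros) auto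
  then have "closed K" unfolding K_def by auto
  have above: "cw_F J a u < cw_F J a y" if "y \<in> K" for y
    using that \<epsilon> by (intro min) (auto simp: K_def V_def m_def)
  define b where "b N = (\<chi> l. real (n N l) / real N)" for N
  have "\<forall>\<^sub>F N in sequentially. (\<integral>y. indicator K y * exp (- real N * cw_F J (b N) y) \<partial>lborel)
      \<le> \<epsilon> * (\<integral>y. exp (- real N * cw_F J (b N) y) \<partial>lborel)"
  proof (rule laplace_concentration[OF J a])
    show "(\<Sum>l\<in>UNIV. b N $ l) = 1" if "N > 0" for N
      using n(1)[of N] that by (simp add: b_def sum_divide_distrib[symmetric] flip: of_nat_sum)
  qed (use n(3) \<open>closed K\<close> \<epsilon> in \<open>auto simp: b_def intro: above\<close>)
  moreover have "\<forall>\<^sub>F N in sequentially. \<forall>l\<in>UNIV. n N l > 0"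
    by (intro eventually_ball_finite ballI eventually_compose_filterlim[OF eventually_gt_at_top n(2)]) simp
  moreover have "\<forall>\<^sub>F N in sequentially. M * (\<Sum>l\<in>UNIV. 8 / real (n N l)) < \<epsilon> / 4"
  proof -
    have "(\<lambda>N. M * (\<Sum>l\<in>(UNIV::'g set). 8 / real (n N l))) \<longlonglongrightarrow> M * (\<Sum>l\<in>(UNIV::'g set). 0)"
      by (intro tendsto_intros real_tendsto_divide_at_top[OF tendsto_const]
          filterlim_compose[OF filterlim_real_sequentially] n(2))
    then show ?thesis using \<epsilon> by (intro order_tendstoD) auto
  qed
  ultimately have "\<forall>\<^sub>F N in sequentially. norm ((\<Sum>x\<in>spin_configs (n N). h (spin_mean (n N) x) * gibbs_weight J (n N) x) / partition_function J (n N) - h m) < \<epsilon>'"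
    using eventually_gt_at_top[of 0]
  proof eventually_elim
    case (elim N)
    let ?S = "spin_configs (n N)" and ?Z = "partition_function J (n N)"
    let ?e = "\<lambda>y x. exp (- real N / 2 * (y \<bullet> (matrix_inv J *v y)) + y \<bullet> spin_sum (n N) x)"
    let ?T = "\<lambda>y. \<Sum>x\<in>?S. ?e y x"
    define C where "C = (\<integral>y. exp (- real N / 2 * (y \<bullet> (matrix_inv J *v y))) \<partial>lborel)"
    let ?d = "\<lambda>x. h (spin_mean (n N) x) - h m"
    note GI = gibbs_sum_integral[OF J n(1) elim(4), folded C_def]
    have T: "?T y = 2 ^ N * exp (- real N * cw_F J (b N) y)" for y
      unfolding b_def by (rule sum_spin_weights_eq_cw_F[OF n(1) elim(4)])
    have intT: "integrable lborel ?T" using GI(1)[of "\<lambda>_. 1"] by simp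
    have CZ: "(\<integral>y. ?T y \<partial>lborel) = C * ?Z" using GI(2)[of "\<lambda>_. 1"] by (simp add: partition_function_def)
    have intK: "integrable lborel (\<lambda>y. indicator K y * ?T y)"
      using integrable_mult_indicator[OF _ intT, of K] \<open>closed K\<close> by simp
    have K: "(\<integral>y. indicator K y * ?T y \<partial>lborel) \<le> \<epsilon> * (C * ?Z)"
    proof -
      let ?G = "\<lambda>y. exp (- real N * cw_F J (b N) y)"
      have "(\<integral>y. indicator K y * ?T y \<partial>lborel) = 2 ^ N * (\<integral>y. indicator K y * ?G y \<partial>lborel)"
        unfolding T mult.left_commute[of "indicator K _"] by (rule integral_mult_right_zero)
      also have "\<dots> \<le> 2 ^ N * (\<epsilon> * (\<integral>y. ?G y \<partial>lborel))"
        by (intro mult_left_mono elim(1)) simp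
      also have "\<dots> = \<epsilon> * (\<integral>y. ?T y \<partial>lborel)"
        unfolding T integral_mult_right_zero by simp
      finally show ?thesis unfolding CZ .
    qed
    \<comment> \<open>Off \<open>K\<close> the budget is \<open>\<epsilon> / 2\<close> from
      continuity of \<open>h\<close>, \<open>\<epsilon> / 4\<close> from fluctuations and
      \<open>\<epsilon> / 4\<close> from bias; on \<open>K\<close> only boundedness is used.\<close>
    have bound: "\<bar>\<Sum>x\<in>?S. ?d x * ?e y x\<bar> \<le> \<epsilon> * ?T y + 2 * B * (indicator K y * ?T y)" for y
    proof -
      let ?E = "exp (- real N / 2 * (y \<bullet> (matrix_inv J *v y)))" and ?w = "\<lambda>x. exp (y \<bullet> spin_sum (n N) x)"
      have T0: "?T y \<ge> 0" by (intro sum_nonneg) auto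
      have "\<bar>\<Sum>x\<in>?S. ?d x * ?e y x\<bar> \<le> (\<Sum>x\<in>?S. \<bar>?d x\<bar> * ?e y x)"
        by (rule order_trans[OF sum_abs]) (simp add: abs_mult)
      also have "\<dots> \<le> \<epsilon> * ?T y + 2 * B * (indicator K y * ?T y)"
      proof (cases "y \<in> K")
        case True
        have "\<bar>?d x\<bar> \<le> 2 * B" for x using h(2)[of "spin_mean (n N) x"] h(2)[of m] by linarith
        then have "(\<Sum>x\<in>?S. \<bar>?d x\<bar> * ?e y x) \<le> (\<Sum>x\<in>?S. 2 * B * ?e y x)"
          by (intro sum_mono mult_right_mono) auto
        also have "\<dots> = 2 * B * ?T y" by (simp only: sum_distrib_left)
        finally show ?thesis using True T0 \<epsilon> by (simp add: add_increasing)
      next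
        case False
        then obtain v where v: "v = m \<or> v = - m" "y \<in> V v" by (auto simp: K_def)
        \<comment> \<open>For \<open>v = - m\<close>, evenness of \<open>h\<close> moves the
          estimate at \<open>m\<close> to the reflected spin mean.\<close>
        have "\<bar>?d x\<bar> \<le> \<epsilon> / 2 + M * (norm (spin_mean (n N) x - v))\<^sup>2" for x
        proof (cases "v = m")
          case True
          then show ?thesis using M(2) by simp
        next
          case False
          then have "norm (spin_mean (n N) x - v) = norm (- spin_mean (n N) x - m)"
            using v(1) norm_minus_cancel[of "spin_mean (n N) x + m"] by simp
          then show ?thesis using M(2)[of "- spin_mean (n N) x"] h(3) by simp
        qed
        then have "(\<Sum>x\<in>?S. \<bar>?d x\<bar> * ?e y x) \<le> (\<Sum>x\<in>?S. (\<epsilon> / 2 + M * (norm (spin_mean (n N) x - v))\<^sup>2) * ?e y x)"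
          by (intro sum_mono mult_right_mono) auto
        also have "\<dots> = \<epsilon> / 2 * ?T y + M * (?E * (\<Sum>x\<in>?S. (norm (spin_mean (n N) x - v))\<^sup>2 * ?w x))"
        proof -
          have "(\<Sum>x\<in>?S. (c + M * q x) * (E * w x)) = c * (\<Sum>x\<in>?S. E * w x) + M * (E * (\<Sum>x\<in>?S. q x * w x))"
            for c E and q w :: "_ \<Rightarrow> real"
            unfolding sum_distrib_left sum.distrib[symmetric] by (intro sum.cong refl) (simp add: algebra_simps)
          then show ?thesis unfolding exp_add .
        qed
        also have "\<dots> \<le> \<epsilon> / 2 * ?T y + M * (?E * ((\<Sum>l\<in>UNIV. 8 / real (n N l) + 2 * (tanh (y $ l) - v $ l)\<^sup>2) * (\<Sum>x\<in>?S. ?w x)))"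
          using elim(2) M(1) by (intro add_left_mono mult_left_mono spin_mean_second_moment) auto
        also have "\<dots> = \<epsilon> / 2 * ?T y + (M * (\<Sum>l\<in>UNIV. 8 / real (n N l)) + M * (\<Sum>l\<in>UNIV. 2 * (tanh (y $ l) - v $ l)\<^sup>2)) * ?T y"
        proof -
          have "?T y = ?E * (\<Sum>x\<in>?S. ?w x)" by (simp only: exp_add sum_distrib_left)
          then show ?thesis
            unfolding sum.distrib by (simp only: distrib_left distrib_right mult.assoc mult.left_commute)
        qed
        also have "\<dots> \<le> \<epsilon> / 2 * ?T y + (\<epsilon> / 4 + \<epsilon> / 4) * ?T y"
          using elim(3) v(2) T0 by (intro add_left_mono mult_right_mono add_mono) (auto simp: V_def)
        also have "\<dots> = \<epsilon> * ?T y" by (simp add: algebra_simps)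
        finally show ?thesis using False by simp
      qed
      finally show ?thesis .
    qed
    have "\<bar>C * (\<Sum>x\<in>?S. ?d x * gibbs_weight J (n N) x)\<bar> \<le> (\<integral>y. \<bar>\<Sum>x\<in>?S. ?d x * ?e y x\<bar> \<partial>lborel)"
      unfolding GI(2)[symmetric] by (rule integral_abs_bound)
    also have "\<dots> \<le> (\<integral>y. \<epsilon> * ?T y + 2 * B * (indicator K y * ?T y) \<partial>lborel)"
      by (intro integral_mono integrable_abs GI(1) bound Bochner_Integration.integrable_add
          integrable_mult_right intT intK)
    also have "\<dots> = \<epsilon> * (C * ?Z) + 2 * B * (\<integral>y. indicator K y * ?T y \<partial>lborel)"
      unfolding CZ[symmetric]
      by (subst Bochner_Integration.integral_add[OF integrable_mult_right[OF intT] integrable_mult_right[OF intK]])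
        (simp only: integral_mult_right_zero)
    also have "\<dots> \<le> \<epsilon> * (C * ?Z) + 2 * B * (\<epsilon> * (C * ?Z))"
      using K B by (intro add_left_mono mult_left_mono) auto
    also have "\<dots> = C * (\<epsilon> * (1 + 2 * B) * ?Z)" by (simp add: algebra_simps)
    also have "\<epsilon> * (1 + 2 * B) = \<epsilon>' / 2" using B by (simp add: \<epsilon>_def field_simps)
    finally have le: "\<bar>C * (\<Sum>x\<in>?S. ?d x * gibbs_weight J (n N) x)\<bar> \<le> C * (\<epsilon>' / 2 * ?Z)" .
    have "C \<ge> 0" unfolding C_def by (intro integral_nonneg_AE) auto
    \<comment> \<open>Otherwise the strictly positive \<open>?T\<close> would vanish almost
      everywhere on a space of nonzero measure.\<close>
    moreover have "C \<noteq> 0"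
    proof
      assume "C = 0"
      then have "(\<integral>y. ?T y \<partial>lborel) = 0" using CZ by simp
      moreover have "AE y in lborel. 0 \<le> ?T y" by (intro AE_I2 sum_nonneg) auto
      ultimately have "AE y in lborel. ?T y = 0"
        by (simp only: integral_nonneg_eq_0_iff_AE[OF intT])
      then have "AE y in (lborel :: (real^'g) measure). False" unfolding T by simp
      then have "emeasure lborel (UNIV :: (real^'g) set) = 0"
        by (subst (asm) AE_iff_measurable[of UNIV]) auto
      then show False by simp
    qed
    ultimately have "C > 0" by simp
    then have "\<bar>\<Sum>x\<in>?S. ?d x * gibbs_weight J (n N) x\<bar> \<le> \<epsilon>' / 2 * ?Z"
      using le unfolding abs_mult by simp
    moreover have "(\<Sum>x\<in>?S. ?d x * gibbs_weight J (n N) x) =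
        (\<Sum>x\<in>?S. h (spin_mean (n N) x) * gibbs_weight J (n N) x) - h m * ?Z"
      unfolding partition_function_def left_diff_distrib sum_subtractf sum_distrib_left ..
    moreover have Z: "?Z > 0" by (rule partition_function_pos)
    moreover have "\<bar>u / z - w\<bar> \<le> e" if "\<bar>u - w * z\<bar> \<le> e * z" "z > 0" for u w z e :: real
    proof -
      have "u / z - w = (u - w * z) / z" using that(2) by (simp add: field_simps)
      then show ?thesis using that by (simp add: abs_divide divide_le_eq)
    qed
    ultimately have "\<bar>(\<Sum>x\<in>?S. h (spin_mean (n N) x) * gibbs_weight J (n N) x) / ?Z - h m\<bar> \<le> \<epsilon>' / 2"
      by metis
    then show ?case using \<open>\<epsilon>' > 0\<close> by simp
  qed
  then show "\<exists>N0. \<forall>N\<ge>N0. norm ((\<Sum>x\<in>spin_configs (n N). h (spin_mean (n N) x) * gibbs_weight J (n N) x) / partition_function J (n N) - h (\<chi> l. tanh (u $ l))) < \<epsilon>'"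
    by (simp add: eventually_sequentially m_def)
qed

text \<open>The measure is the law of a fair coin's choice between \<open>u\<close> and
  \<open>v\<close>, which makes the integral a two-point average.\<close>

lemma integral_half_add_return:
  fixes f :: "'a::t2_space \<Rightarrow> real"
  assumes "continuous_on UNIV f"
  shows "(\<integral>x. f x \<partial>scale_measure (1/2) (add_measure (return borel u) (return borel v))) = (f u + f v) / 2"
proof -
  let ?D = "distr (bernoulli_pmf (1/2)) borel (\<lambda>c. if c then u else v)"
  have "scale_measure (1/2) (add_measure (return borel u) (return borel v)) = ?D"
  proof (rule measure_eqI)
    fix A assume "A \<in> sets (scale_measure (1/2) (add_measure (return borel u) (return borel v)))"
    then have A: "A \<in> sets borel" by simp
    have half: "(1/2 :: ennreal) = ennreal (1/2)"
      by (simp add: divide_ennreal_def)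
    have "emeasure ?D A = (\<integral>\<^sup>+z. indicator A z \<partial>?D)"
      using A by simp
    also have "\<dots> = (\<integral>\<^sup>+c. indicator A (if c then u else v) \<partial>bernoulli_pmf (1/2))"
      using A by (intro nn_integral_distr) auto
    also have "\<dots> = (1/2) * (indicator A u + indicator A v)"
      by (simp add: half distrib_left mult.commute)
    finally show "emeasure (scale_measure (1/2) (add_measure (return borel u) (return borel v))) A = emeasure ?D A"
      using A by (simp add: emeasure_add_measure)
  qed simp
  then have "(\<integral>x. f x \<partial>scale_measure (1/2) (add_measure (return borel u) (return borel v))) = (\<integral>x. f x \<partial>?D)"
    by simp
  also have "\<dots> = (\<integral>c. f (if c then u else v) \<partial>bernoulli_pmf (1/2))"
    using assms by (intro integral_distr borel_measurable_continuous_onI) auto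
  finally show ?thesis by (simp add: field_simps)
qed

text \<open>Spin-flip symmetry lets the test function be replaced by its even part \<open>h\<close>;
  the limit \<open>h m\<close> is the average of \<open>f\<close> over \<open>m\<close> and
  \<open>- m\<close>.\<close>

lemma curie_weiss_weak_convergence:
  fixes J :: "real^'g^'g" and n :: "nat \<Rightarrow> 'g::finite \<Rightarrow> nat"
  assumes J: "transpose J = J" "positive_definite J"
    and a: "\<And>l. a $ l \<ge> 0" "(\<Sum>l\<in>UNIV. a $ l) = 1"
    and n: "\<And>N. (\<Sum>l\<in>UNIV. n N l) = N" "\<And>l. filterlim (\<lambda>N. n N l) at_top sequentially"
      "\<And>l. (\<lambda>N. real (n N l) / real N) \<longlonglongrightarrow> a $ l"
    and min: "\<And>y. y \<noteq> u \<Longrightarrow> y \<noteq> - u \<Longrightarrow> cw_F J a u < cw_F J a y"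
    and model: "\<And>N. curie_weiss_model J (n N) (P N) (X N)"
    and m: "m = (\<chi> l. tanh (u $ l))"
  shows "weakly_converges (\<lambda>N. distr (P N) borel (magnetization (n N) (X N)))
         (scale_measure (1/2) (add_measure (return borel (- m)) (return borel m)))"
  unfolding weakly_converges_def
proof (intro allI impI)
  fix f :: "real^'g \<Rightarrow> real" assume f: "continuous_on UNIV f \<and> bounded (range f)"
  define h where "h z = (f z + f (- z)) / 2" for z
  obtain B where B: "\<And>z. \<bar>f z\<bar> \<le> B" using f by (auto simp: bounded_iff)
  have "continuous_on UNIV h"
    unfolding h_def using f
    by (auto intro!: continuous_intros continuous_on_compose2[of UNIV f UNIV uminus])
  moreover have "\<bar>h z\<bar> \<le> B" for z using B[of z] B[of "- z"] by (simp add: h_def abs_le_iff)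
  moreover have "h (- z) = h z" for z by (simp add: h_def)
  ultimately have "(\<lambda>N. (\<Sum>x\<in>spin_configs (n N). h (spin_mean (n N) x) * gibbs_weight J (n N) x) / partition_function J (n N))
     \<longlonglongrightarrow> h m"
    unfolding m by (intro gibbs_even_limit[OF J a n min, where B = B])
  moreover have "(\<Sum>x\<in>spin_configs (n N). h (spin_mean (n N) x) * gibbs_weight J (n N) x) =
      (\<Sum>x\<in>spin_configs (n N). f (spin_mean (n N) x) * gibbs_weight J (n N) x)" for N
    using sum_spin_configs_flip[of f "n N" J]
    by (simp add: h_def add_divide_distrib distrib_right sum.distrib flip: sum_divide_distrib)
  ultimately show "(\<lambda>N. \<integral>x. f x \<partial>distr (P N) borel (magnetization (n N) (X N)))
      \<longlonglongrightarrow> (\<integral>x. f x \<partial>scale_measure (1/2) (add_measure (return borel (- m)) (return borel m)))"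
    using f by (simp add: curie_weiss_expectation[OF model] integral_half_add_return h_def add.commute)
qed

theorem theorem22:
  fixes J :: "real^'g^'g"
    and \<alpha> :: "real^'g"
    and n :: "nat \<Rightarrow> 'g::finite \<Rightarrow> nat"
    and P :: "nat \<Rightarrow> 'a measure"
    and X :: "nat \<Rightarrow> 'g \<Rightarrow> nat \<Rightarrow> 'a \<Rightarrow> real"
  assumes group_sizes: "\<And>N. (\<Sum>l\<in>UNIV. n N l) = N"
    and group_sizes_at_top: "\<And>l. filterlim (\<lambda>N. n N l) at_top sequentially"
    and group_ratios: "\<And>l. (\<lambda>N. real (n N l) / real N) \<longlonglongrightarrow> \<alpha> $ l"
    and alpha_nonneg: "\<And>l. \<alpha> $ l \<ge> 0"
    and alpha_sum: "(\<Sum>l\<in>UNIV. \<alpha> $ l) = 1"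
    and J_symmetric: "transpose J = J"
    and J_pos_def: "positive_definite J"
    and J_positive: "\<And>l k. J $ l $ k > 0"
    and model: "\<And>N. curie_weiss_model J (n N) (P N) (X N)"
    and low_temperature: "\<not> positive_semidefinite (matrix_inv J - diagonal_matrix \<alpha>)"
    and one_local_minimum:
      "\<And>s y z. (\<forall>l. s $ l \<in> {-1, 1}) \<Longrightarrow>
         y \<in> orthant s \<Longrightarrow> local_minimum (cw_F J \<alpha>) y \<Longrightarrow>
         z \<in> orthant s \<Longrightarrow> local_minimum (cw_F J \<alpha>) z \<Longrightarrow> y = z"
  shows "(\<exists>!mbar. mbar \<in> orthant (\<chi> l. 1) \<and> local_minimum (cw_F J \<alpha>) mbar) \<and>
    (\<forall>mbar m. mbar \<in> orthant (\<chi> l. 1) \<and> local_minimum (cw_F J \<alpha>) mbar \<and> m = (\<chi> l. tanh (mbar $ l)) \<longrightarrow>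
       weakly_converges (\<lambda>N. distr (P N) borel (magnetization (n N) (X N)))
         (scale_measure (1/2) (add_measure (return borel (- m)) (return borel m))))"
proof -
  let ?F = "cw_F J \<alpha>" and ?pos = "orthant (\<chi> l. 1) :: (real^'g) set"
  obtain y0 where y0: "\<And>z. ?F y0 \<le> ?F z"
    using cw_F_minimizer_exists[OF J_symmetric J_pos_def alpha_nonneg alpha_sum] by blast
  have unique: "y = z" if "y \<in> ?pos" "local_minimum ?F y" "z \<in> ?pos" "local_minimum ?F z" for y z
    using one_local_minimum[of "\<chi> l. 1" y z] that by simp
  \<comment> \<open>Low temperature rules out \<open>0\<close>, so every global minimizer lies in
    the positive orthant up to sign; evenness of \<open>cw_F\<close> makes its negative a minimizer
    too.\<close>
  have global: "(y \<in> ?pos \<or> - y \<in> ?pos) \<and> local_minimum ?F y \<and> local_minimum ?F (- y)"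
    if y: "?F y = ?F y0" for y
  proof -
    have min: "?F y \<le> ?F z" for z using y0[of z] y by simp
    have "y \<noteq> 0"
      using zero_not_cw_F_minimizer[OF J_symmetric J_pos_def low_temperature] min by (auto simp: not_less[symmetric])
    then have "(\<forall>l. y $ l > 0) \<or> (\<forall>l. y $ l < 0)"
      using cw_F_minimizer_orthant[OF J_symmetric J_pos_def J_positive alpha_nonneg min] by blast
    moreover have "?F (- y) \<le> ?F z" for z using min[of z] by (simp add: cw_F_uminus)
    ultimately show ?thesis using min by (auto simp: orthant_def local_minimum_def)
  qed
  obtain u where u: "u \<in> ?pos" "local_minimum ?F u" "?F u = ?F y0"
    using global[of y0] global[of "- y0"] by (metis cw_F_uminus)
  \<comment> \<open>If \<open>y\<close> tied with \<open>u\<close>, then \<open>y\<close> or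
    \<open>- y\<close> would be a local minimum in the positive orthant and hence equal to
    \<open>u\<close>.\<close>
  have strict: "?F u < ?F y" if "y \<noteq> u" "y \<noteq> - u" for y
  proof (rule ccontr)
    assume "\<not> ?F u < ?F y"
    then have "?F y = ?F y0" using u(3) y0[of y] by simp
    from global[OF this] show False
      using unique[OF u(1,2)] that by (metis minus_minus)
  qed
  have "\<exists>!mbar. mbar \<in> ?pos \<and> local_minimum ?F mbar"
    using u unique by blast
  moreover have "weakly_converges (\<lambda>N. distr (P N) borel (magnetization (n N) (X N)))
         (scale_measure (1/2) (add_measure (return borel (- m)) (return borel m)))"
    if "mbar \<in> ?pos" "local_minimum ?F mbar" "m = (\<chi> l. tanh (mbar $ l))" for mbar m
  proof -
    have "mbar = u" using unique that u by blast
    then show ?thesis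
      using that(3) by (intro curie_weiss_weak_convergence[OF J_symmetric J_pos_def alpha_nonneg alpha_sum
            group_sizes group_sizes_at_top group_ratios strict model]) auto
  qed
  ultimately show ?thesis by blast
qed

end
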